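(* Let $n\ge 1$ be a fixed integer and let $\lambda_g,\lambda_r\ge 0$. Consider the open multi-agent system of constant size $n(t)=n$ described in the context, subject only to gossip interactions (triggered by a Poisson clock of rate $n\lambda_g$) and random replacements (triggered by an independent Poisson clock of rate $n\lambda_r$). Let $X(t)=\begin{pmatrix}\bar x(t)^2 & \overline{x^2}(t)\end{pmatrix}^\top$. Then $$\frac{d}{dt}\,\mathbb{E}X(t)=\begin{pmatrix}-2\lambda_r & \frac{\lambda_r}{n}\\ \lambda_g & -(\lambda_g+\lambda_r)\end{pmatrix}\mathbb{E}X(t)+\lambda_r\begin{pmatrix}\frac1n\\ 1\end{pmatrix}\sigma^2 .$$
   Context: The system consists at each time $t\ge0$ of $n$ agents, each agent $i$ holding a value $x_i(t)\in\mathbb{R}$. The values at time $0$ are drawn independently from a distribution $\mathcal D$ with bounded support, mean $0$ and variance $\sigma^2$. The descriptors are $\bar x^2=\left(\frac1n\sum_i x_i\right)^2$ (squared mean) and $\overline{x^2}=\frac1n\sum_i x_i^2$ (mean of squares), the sums being over the agents present at the considered time. The values only change at the activation times of two independent Poisson clocks: - Gossip interaction: two agents $i,j$ among the $n$ present are selected independently and uniformly at random (possibly $i=j$), and both values are replaced by $\frac{x_i+x_j}{2}$; other values are unchanged. - Random replacement: one of the $n$ present agents, chosen uniformly at random, leaves the system and is simultaneously replaced by a new agent whose value is drawn from $\mathcal D$; other values are unchanged. All clocks, random selections and draws from $\mathcal D$ are mutually independent. *)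

theory Defs
  imports "HOL-Probability.Probability"
begin

text \<open>
  A Poisson clock is represented by its counting process: \<open>N t\<close> is the number of activations in
  \<open>(0, t]\<close>. The law of the increments is given by its probability mass function because
  \<^const>\<open>poisson_pmf\<close> is only specified for positive rates, whereas here a clock of rate \<open>0\<close>
  (which almost surely never activates) is allowed. Almost surely \<open>N\<close> is monotone, so the
  truncation in the subtraction of naturals is irrelevant.
\<close>

definition (in prob_space) poisson_clock :: "real \<Rightarrow> (real \<Rightarrow> 'a \<Rightarrow> nat) \<Rightarrow> bool" where
  "poisson_clock rate N \<longleftrightarrow>
     (\<forall>t\<ge>0. random_variable (count_space UNIV) (N t)) \<and>
     (AE \<omega> in M. N 0 \<omega> = 0 \<and>
        mono_on {0..} (\<lambda>t. N t \<omega>) \<and>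
        (\<forall>t\<ge>0. continuous (at_right t) (\<lambda>s. N s \<omega>))) \<and>
     (\<forall>u::nat \<Rightarrow> real. 0 \<le> u 0 \<longrightarrow> incseq u \<longrightarrow>
        indep_vars (\<lambda>_. count_space UNIV) (\<lambda>j \<omega>. N (u (Suc j)) \<omega> - N (u j) \<omega>) UNIV) \<and>
     (\<forall>s\<ge>0. \<forall>t\<ge>s. \<forall>k.
        prob {\<omega> \<in> space M. N t \<omega> - N s \<omega> = k} =
          (rate * (t - s)) ^ k / fact k * exp (- (rate * (t - s))))"

definition gossip :: "nat \<Rightarrow> nat \<Rightarrow> (nat \<Rightarrow> real) \<Rightarrow> nat \<Rightarrow> real" where
  "gossip i j v = v(i := (v i + v j) / 2, j := (v i + v j) / 2)"

definition replacement :: "nat \<Rightarrow> real \<Rightarrow> (nat \<Rightarrow> real) \<Rightarrow> nat \<Rightarrow> real" where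
  "replacement i z v = v(i := z)"

definition squared_mean :: "nat \<Rightarrow> (nat \<Rightarrow> real) \<Rightarrow> real" where
  "squared_mean n v = ((\<Sum>i<n. v i) / real n)\<^sup>2"

definition mean_of_squares :: "nat \<Rightarrow> (nat \<Rightarrow> real) \<Rightarrow> real" where
  "mean_of_squares n v = (\<Sum>i<n. (v i)\<^sup>2) / real n"

definition descriptors :: "nat \<Rightarrow> (nat \<Rightarrow> real) \<Rightarrow> real ^ 2" where
  "descriptors n v = vector [squared_mean n v, mean_of_squares n v]"

text \<open>The sources of randomness, indexed so that their mutual independence can be stated.\<close>

datatype source =
    Initial nat
  | Gossip_Clock
  | Replacement_Clock
  | First nat
  | Second nat
  | Leaving nat
  | Arrival nat

text \<open>
  Agents are the slots \<open>i < n\<close>, a newcomer taking over the slot of the agent it replaces.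
  \<open>x t \<omega> i\<close> is the value held by agent \<open>i\<close> at time \<open>t\<close>. The activations of each clock are numbered
  from \<open>0\<close>: the activation at which \<open>Ng\<close> jumps from \<open>k\<close> to \<open>k + 1\<close> is a gossip interaction between
  the agents \<open>a k\<close> and \<open>b k\<close>, and the one at which \<open>Nr\<close> jumps from \<open>k\<close> to \<open>k + 1\<close> replaces the agent
  \<open>c k\<close> by one of value \<open>z k\<close>.
\<close>

locale open_gossip_system = prob_space M
  for M :: "'w measure" +
  fixes n :: nat
    and lam_g lam_r :: real
    and D :: "real measure"
    and \<sigma> :: real
    and Ng Nr :: "real \<Rightarrow> 'w \<Rightarrow> nat"
    and a b c :: "nat \<Rightarrow> 'w \<Rightarrow> nat"
    and z :: "nat \<Rightarrow> 'w \<Rightarrow> real"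
    and x :: "real \<Rightarrow> 'w \<Rightarrow> nat \<Rightarrow> real"
  assumes D_prob: "prob_space D"
    and D_sets: "sets D = sets borel"
    and D_bounded_support: "\<exists>B. AE y in D. \<bar>y\<bar> \<le> B"
    and D_mean: "prob_space.expectation D (\<lambda>y. y) = 0"
    and D_variance: "prob_space.variance D (\<lambda>y. y) = \<sigma>\<^sup>2"
    and gossip_clock: "poisson_clock (real n * lam_g) Ng"
    and replacement_clock: "poisson_clock (real n * lam_r) Nr"
    and a_measurable: "\<And>k. random_variable (count_space UNIV) (a k)"
    and b_measurable: "\<And>k. random_variable (count_space UNIV) (b k)"
    and c_measurable: "\<And>k. random_variable (count_space UNIV) (c k)"
    and z_measurable: "\<And>k. random_variable borel (z k)"
    and x_measurable: "\<And>t i. 0 \<le> t \<Longrightarrow> i < n \<Longrightarrow> random_variable borel (\<lambda>\<omega>. x t \<omega> i)"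
    and a_uniform: "\<And>k. distr M (count_space UNIV) (a k) = measure_pmf (pmf_of_set {..<n})"
    and b_uniform: "\<And>k. distr M (count_space UNIV) (b k) = measure_pmf (pmf_of_set {..<n})"
    and c_uniform: "\<And>k. distr M (count_space UNIV) (c k) = measure_pmf (pmf_of_set {..<n})"
    and z_distributed: "\<And>k. distr M borel (z k) = D"
    and initial_distributed: "\<And>i. i < n \<Longrightarrow> distr M borel (\<lambda>\<omega>. x 0 \<omega> i) = D"
    and mutually_independent:
      "indep_sets
         (\<lambda>s. sets (case s of
            Initial i \<Rightarrow> vimage_algebra (space M) (\<lambda>\<omega>. x 0 \<omega> i) borel
          | Gossip_Clock \<Rightarrow> vimage_algebra (space M) (\<lambda>\<omega>. \<lambda>t\<in>{0..}. Ng t \<omega>)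
              (PiM {0..} (\<lambda>_. count_space UNIV))
          | Replacement_Clock \<Rightarrow> vimage_algebra (space M) (\<lambda>\<omega>. \<lambda>t\<in>{0..}. Nr t \<omega>)
              (PiM {0..} (\<lambda>_. count_space UNIV))
          | First k \<Rightarrow> vimage_algebra (space M) (a k) (count_space UNIV)
          | Second k \<Rightarrow> vimage_algebra (space M) (b k) (count_space UNIV)
          | Leaving k \<Rightarrow> vimage_algebra (space M) (c k) (count_space UNIV)
          | Arrival k \<Rightarrow> vimage_algebra (space M) (z k) borel))
         (Initial ` {..<n} \<union> {Gossip_Clock, Replacement_Clock} \<union>
            range First \<union> range Second \<union> range Leaving \<union> range Arrival)"
    \<comment> \<open>The dynamics, stated on every interval \<open>(s, t]\<close> containing at most one activation. Since the
      paths of the clocks almost surely have unit jumps, finitely many in bounded time and none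
      in common, this determines \<open>x\<close> almost surely from its initial value.\<close>
    and no_activation:
      "AE \<omega> in M. \<forall>s\<ge>0. \<forall>t>s. Ng t \<omega> = Ng s \<omega> \<longrightarrow> Nr t \<omega> = Nr s \<omega> \<longrightarrow>
         (\<forall>i<n. x t \<omega> i = x s \<omega> i)"
    and gossip_activation:
      "AE \<omega> in M. \<forall>s\<ge>0. \<forall>t>s. Ng t \<omega> = Suc (Ng s \<omega>) \<longrightarrow> Nr t \<omega> = Nr s \<omega> \<longrightarrow>
         (\<forall>i<n. x t \<omega> i = gossip (a (Ng s \<omega>) \<omega>) (b (Ng s \<omega>) \<omega>) (x s \<omega>) i)"
    and replacement_activation:
      "AE \<omega> in M. \<forall>s\<ge>0. \<forall>t>s. Ng t \<omega> = Ng s \<omega> \<longrightarrow> Nr t \<omega> = Suc (Nr s \<omega>) \<longrightarrow>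
         (\<forall>i<n. x t \<omega> i = replacement (c (Nr s \<omega>) \<omega>) (z (Nr s \<omega>) \<omega>) (x s \<omega>) i)"

end

theory Submission
  imports Defs
begin

text \<open>
  Let \<open>f\<close> be one of the two descriptors. Over a window \<open>(s, s + h]\<close> the clocks show no
  activation, exactly one gossip, exactly one replacement, or at least two activations, the last
  with probability \<open>O(h\<^sup>2)\<close>. Since the values are bounded and the state at time \<open>s\<close> is independent of
  the clock increments over the window and of the next agents and the next arrival to be drawn, the
  mean of \<open>f\<close> changes by \<open>h\<close> times a linear function of the two moments at time \<open>s\<close>, up to
  \<open>O(h\<^sup>2)\<close> uniformly in \<open>s\<close>; the uniformity also yields the left derivative.

  The dynamics determine the state only across windows with at most one activation. To obtain
  independence and boundedness, cut \<open>(0, s]\<close> into \<open>m\<close> cells. Unless some cell has two activations,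
  which has probability \<open>O(1/m)\<close>, the state at time \<open>s\<close> on the event of \<open>k\<close> past gossips and \<open>l\<close> past
  replacements is a function of the initial values, the increments over the cells, the first \<open>k\<close>
  selected pairs and the first \<open>l\<close> replacements. Then \<open>m\<close> tends to infinity.
\<close>

section \<open>Independence and derivatives\<close>

text \<open>Two obstacles shape the proof. The first is that mutual independence is given for whole
  clock paths, whereas independence of increments is a property of each clock on its own. A single
  independent family that contains both the draws and the increments over cells has to be built, by
  refining each clock into one family per cell. The second is that the draws used in the window have
  the random indices \<open>Ng s\<close> and \<open>Nr s\<close>, so they are not themselves members
  of that family. Expectations are therefore split over the values \<open>k\<close>,
  \<open>l\<close> of the counts. On each piece the past involves only draws numbered below
  \<open>k\<close> and \<open>l\<close>, the window only those numbered exactly \<open>k\<close> and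
  \<open>l\<close>, and two disjoint index sets face each other. The expectation of the window
  factor is the same for all \<open>k\<close> and \<open>l\<close>, which lets the pieces
  recombine.\<close>

lemma (in prob_space) indep_sets_refine:
  assumes indep: "indep_sets F I"
    and Int_closed: "\<And>i. i \<in> I \<Longrightarrow> Int_stable (F i)"
    and fine: "\<And>i. i \<in> I \<Longrightarrow> indep_sets (G i) (J i)"
    and sub: "\<And>i j. i \<in> I \<Longrightarrow> j \<in> J i \<Longrightarrow> G i j \<subseteq> F i"
  shows "indep_sets (\<lambda>(i, j). G i j) (Sigma I J)"
proof (rule indep_setsI)
  fix p assume "p \<in> Sigma I J"
  then show "(case p of (i, j) \<Rightarrow> G i j) \<subseteq> events"
    using fine by (auto simp: indep_sets_def)
next
  fix A :: "'b \<times> 'c \<Rightarrow> 'a set" and K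
  assume K: "K \<noteq> {}" "K \<subseteq> Sigma I J" "finite K"
    and A: "\<forall>p\<in>K. A p \<in> (case p of (i, j) \<Rightarrow> G i j)"
  \<comment> \<open>Grouping by the first index: each \<open>B i\<close> lies in \<open>F i\<close>
    by stability under intersections, so independence of \<open>F\<close> factors over
    \<open>i\<close>, and independence of \<open>G i\<close> then factors inside each group.\<close>
  define B where "B i = (\<Inter>j\<in>K `` {i}. A (i, j))" for i
  have fin: "finite (K `` {i})" for i
    using K(3) by (rule finite_Image)
  have ne: "K `` {i} \<noteq> {}" if "i \<in> fst ` K" for i
    using that by force
  have B: "B i \<in> F i" if i: "i \<in> fst ` K" for i
  proof -
    have "Int_stable (F i)" "\<And>j. j \<in> K `` {i} \<Longrightarrow> A (i, j) \<in> F i"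
      using K(2) A i sub Int_closed by fastforce+
    from fin ne[OF i] this(2) have "(\<Inter>j\<in>K `` {i}. A (i, j)) \<in> F i"
      by (induction rule: finite_ne_induct) (auto intro: Int_stableD[OF \<open>Int_stable (F i)\<close>])
    then show ?thesis by (simp add: B_def)
  qed
  have "(\<Inter>p\<in>K. A p) = (\<Inter>i\<in>fst ` K. B i)"
    unfolding B_def by force
  also have "prob \<dots> = (\<Prod>i\<in>fst ` K. prob (B i))"
    using K B by (intro indep_setsD[OF indep]) auto
  also have "\<dots> = (\<Prod>i\<in>fst ` K. \<Prod>j\<in>K `` {i}. prob (A (i, j)))"
  proof (rule prod.cong[OF refl])
    fix i assume i: "i \<in> fst ` K"
    then have "i \<in> I" "K `` {i} \<subseteq> J i" "\<forall>j\<in>K `` {i}. A (i, j) \<in> G i j"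
      using K(2) A by auto
    with indep_setsD[OF fine, of i "K `` {i}" "\<lambda>j. A (i, j)"] fin ne[OF i]
    show "prob (B i) = (\<Prod>j\<in>K `` {i}. prob (A (i, j)))"
      by (simp add: B_def)
  qed
  also have "\<dots> = (\<Prod>p\<in>Sigma (fst ` K) (\<lambda>i. K `` {i}). prob (A p))"
    using K fin by (subst prod.Sigma) (auto simp: case_prod_unfold)
  also have "Sigma (fst ` K) (\<lambda>i. K `` {i}) = K"
    by force
  finally show "prob (\<Inter>p\<in>K. A p) = (\<Prod>p\<in>K. prob (A p))" .
qed

text \<open>Disjoint groups of an independent family of pi-systems generate independent
  sigma-algebras, and functions measurable for these are independent random variables.\<close>

lemma (in prob_space) indep_sets_expectation_mult:
  fixes f g :: "'a \<Rightarrow> real"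
  assumes indep: "indep_sets F I"
    and Int_stable: "\<And>i. i \<in> I \<Longrightarrow> Int_stable (F i)"
    and J: "J \<subseteq> I" and K: "K \<subseteq> I" and disj: "J \<inter> K = {}"
    and f: "f \<in> borel_measurable (sigma (space M) (\<Union>i\<in>J. F i))" "integrable M f"
    and g: "g \<in> borel_measurable (sigma (space M) (\<Union>i\<in>K. F i))" "integrable M g"
  shows "integrable M (\<lambda>\<omega>. f \<omega> * g \<omega>)"
    and "expectation (\<lambda>\<omega>. f \<omega> * g \<omega>) = expectation f * expectation g"
proof -
  let ?S = "\<lambda>J. sigma_sets (space M) (\<Union>i\<in>J. F i)"
  have "indep_sets (\<lambda>b. ?S (case_bool J K b)) UNIV"
  proof (rule indep_sets_collect_sigma)
    show "indep_sets F (\<Union>b. case_bool J K b)"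
      by (rule indep_sets_mono_index[OF _ indep]) (use J K in \<open>auto split: bool.splits\<close>)
    show "Int_stable (F i)" if "i \<in> case_bool J K b" for b i
      using that J K Int_stable by (auto split: bool.splits)
    show "disjoint_family (case_bool J K)"
      using disj by (auto simp: disjoint_family_on_def split: bool.splits)
  qed
  also have "(\<lambda>b. ?S (case_bool J K b)) = case_bool (?S J) (?S K)"
    by (rule ext) (simp split: bool.split)
  finally have *: "indep_sets (case_bool (?S J) (?S K)) UNIV" .
  have sub: "(\<Union>i\<in>L. F i) \<subseteq> Pow (space M)" if "L \<subseteq> I" for L
  proof -
    have "F i \<subseteq> events" if "i \<in> I" for i
      using indep that by (simp add: indep_sets_def)
    then have "F i \<subseteq> Pow (space M)" if "i \<in> L" for i
      using \<open>L \<subseteq> I\<close> that sets.space_closed[of M] by (meson subsetD subset_trans)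
    then show ?thesis
      by (rule UN_least)
  qed
  have vim: "sigma_sets (space M) {h -` A \<inter> space M | A. A \<in> sets borel} \<subseteq> ?S L"
    if "h \<in> borel_measurable (sigma (space M) (\<Union>i\<in>L. F i))" "L \<subseteq> I" for h :: "'a \<Rightarrow> real" and L
  proof (rule sigma_algebra.sigma_sets_subset)
    show "sigma_algebra (space M) (?S L)"
      by (rule sigma_algebra_sigma_sets[OF sub[OF that(2)]])
    show "{h -` A \<inter> space M | A. A \<in> sets borel} \<subseteq> ?S L"
      using measurable_sets[OF that(1)] sub[OF that(2)]
      by (auto simp: sets_measure_of space_measure_of_conv)
  qed
  have "indep_var borel f borel g"
    unfolding indep_var_eq indep_set_def
  proof (intro conjI indep_sets_mono_sets[OF *])
    show "random_variable borel f" "random_variable borel g"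
      using f(2) g(2) by auto
    show "case_bool (sigma_sets (space M) {f -` A \<inter> space M | A. A \<in> sets borel})
        (sigma_sets (space M) {g -` A \<inter> space M | A. A \<in> sets borel}) b \<subseteq> case_bool (?S J) (?S K) b" for b
      using vim[OF f(1) J] vim[OF g(1) K] by (cases b) simp_all
  qed
  from indep_var_lebesgue_integral[OF this f(2) g(2)] indep_var_integrable[OF this f(2) g(2)]
  show "expectation (\<lambda>\<omega>. f \<omega> * g \<omega>) = expectation f * expectation g"
    "integrable M (\<lambda>\<omega>. f \<omega> * g \<omega>)" by auto
qed

text \<open>The estimate \<open>incr\<close> only looks forward. For a point to the left of
  \<open>t\<close> it is applied from that point, and \<open>lip\<close> exchanges the slope there
  for the slope at \<open>t\<close> at a cost of \<open>L * h\<^sup>2\<close>, the same order as the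
  error already present.\<close>

lemma has_real_derivative_from_increments:
  fixes e g :: "real \<Rightarrow> real"
  assumes incr: "\<And>s h. 0 \<le> s \<Longrightarrow> 0 \<le> h \<Longrightarrow> h \<le> 1 \<Longrightarrow> \<bar>e (s + h) - e s - h * g s\<bar> \<le> C * h\<^sup>2"
    and lip: "\<And>s h. 0 \<le> s \<Longrightarrow> 0 \<le> h \<Longrightarrow> h \<le> 1 \<Longrightarrow> \<bar>g (s + h) - g s\<bar> \<le> L * h"
    and t: "0 \<le> t"
  shows "(e has_real_derivative g t) (at t within {0..})"
proof -
  have bound: "\<bar>e y - e t - (y - t) * g t\<bar> \<le> (\<bar>C\<bar> + \<bar>L\<bar>) * (y - t)\<^sup>2" if "0 \<le> y" "\<bar>y - t\<bar> \<le> 1" for y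
  proof (cases "t \<le> y")
    case True
    have "\<bar>e y - e t - (y - t) * g t\<bar> \<le> C * (y - t)\<^sup>2"
      using incr[of t "y - t"] t True that by simp
    also have "\<dots> \<le> (\<bar>C\<bar> + \<bar>L\<bar>) * (y - t)\<^sup>2"
      by (intro mult_right_mono) auto
    finally show ?thesis .
  next
    case False
    define h where "h = t - y"
    have h: "0 \<le> h" "h \<le> 1" "t = y + h" using False that by (auto simp: h_def)
    have "\<bar>e t - e y - h * g y\<bar> \<le> C * h\<^sup>2" "\<bar>g t - g y\<bar> \<le> L * h"
      using incr[of y h] lip[of y h] that h by auto
    moreover have "e y - e t - (y - t) * g t = h * (g t - g y) - (e t - e y - h * g y)"
      using h by (simp add: algebra_simps)
    moreover have "\<bar>h * (g t - g y)\<bar> \<le> h * (L * h)"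
      using calculation(2) h by (simp add: abs_mult mult_left_mono)
    ultimately have "\<bar>e y - e t - (y - t) * g t\<bar> \<le> (C + L) * h\<^sup>2"
      by (simp add: power2_eq_square algebra_simps)
    also have "\<dots> \<le> (\<bar>C\<bar> + \<bar>L\<bar>) * h\<^sup>2"
      by (intro mult_right_mono) auto
    finally show ?thesis by (simp add: h_def power2_commute)
  qed
  define E where "E y = (e y - e t - (y - t) * g t) / (y - t)" for y
  have "(E \<longlongrightarrow> 0) (at t within {0..})"
  proof (rule Lim_null_comparison)
    have "\<forall>\<^sub>F y in at t within {0..}. dist y t < 1 \<and> y \<in> {0..} \<and> y \<noteq> t"
      unfolding eventually_at by (intro exI[of _ 1]) auto
    then show "\<forall>\<^sub>F y in at t within {0..}. norm (E y) \<le> (\<bar>C\<bar> + \<bar>L\<bar>) * \<bar>y - t\<bar>"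
    proof eventually_elim
      case (elim y)
      then have "\<bar>e y - e t - (y - t) * g t\<bar> \<le> (\<bar>C\<bar> + \<bar>L\<bar>) * (\<bar>y - t\<bar> * \<bar>y - t\<bar>)"
        using bound[of y] by (simp add: dist_real_def power2_eq_square)
      then show ?case
        using elim by (simp add: E_def abs_divide divide_le_eq mult.assoc)
    qed
    show "((\<lambda>y. (\<bar>C\<bar> + \<bar>L\<bar>) * \<bar>y - t\<bar>) \<longlongrightarrow> 0) (at t within {0..})"
      by (auto intro!: tendsto_eq_intros)
  qed
  then have "((\<lambda>y. E y + g t) \<longlongrightarrow> g t) (at t within {0..})"
    by (auto intro!: tendsto_eq_intros)
  then show ?thesis
    unfolding has_field_derivative_iff
  proof (rule Lim_transform_eventually)
    show "\<forall>\<^sub>F y in at t within {0..}. E y + g t = (e y - e t) / (y - t)"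
      unfolding eventually_at by (intro exI[of _ 1]) (auto simp: E_def field_simps)
  qed
qed

section \<open>Independence of the sources across the cells of a grid\<close>

lemma measurable_count_space_binary:
  fixes f g :: "'a \<Rightarrow> nat"
  assumes "f \<in> measurable M (count_space UNIV)" "g \<in> measurable M (count_space UNIV)"
  shows "(\<lambda>\<omega>. h (f \<omega>) (g \<omega>)) \<in> measurable M (count_space UNIV)"
  by (rule measurable_compose_countable[OF measurable_compose_countable[OF _ assms(1)] assms(2)]) simp

lemma (in prob_space) poisson_clock_mono:
  assumes "poisson_clock r N"
  shows "AE \<omega> in M. \<forall>s\<ge>0. \<forall>t\<ge>s. N s \<omega> \<le> N t \<omega>"
proof -
  have "AE \<omega> in M. mono_on {0..} (\<lambda>t. N t \<omega>)"
    using assms unfolding poisson_clock_def by (auto elim: AE_mp)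
  then show ?thesis
    by eventually_elim (auto simp: mono_on_def)
qed

locale gossip_dynamics = open_gossip_system +
  assumes n_pos: "n \<ge> 1" and lam_g_nonneg: "lam_g \<ge> 0" and lam_r_nonneg: "lam_r \<ge> 0"
begin

definition source_events :: "source \<Rightarrow> 'a set set" where
  "source_events s = sets (case s of
      Initial i \<Rightarrow> vimage_algebra (space M) (\<lambda>\<omega>. x 0 \<omega> i) borel
    | Gossip_Clock \<Rightarrow> vimage_algebra (space M) (\<lambda>\<omega>. \<lambda>t\<in>{0..}. Ng t \<omega>)
        (PiM {0..} (\<lambda>_. count_space UNIV))
    | Replacement_Clock \<Rightarrow> vimage_algebra (space M) (\<lambda>\<omega>. \<lambda>t\<in>{0..}. Nr t \<omega>)
        (PiM {0..} (\<lambda>_. count_space UNIV))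
    | First k \<Rightarrow> vimage_algebra (space M) (a k) (count_space UNIV)
    | Second k \<Rightarrow> vimage_algebra (space M) (b k) (count_space UNIV)
    | Leaving k \<Rightarrow> vimage_algebra (space M) (c k) (count_space UNIV)
    | Arrival k \<Rightarrow> vimage_algebra (space M) (z k) borel)"

definition sources :: "source set" where
  "sources = Initial ` {..<n} \<union> {Gossip_Clock, Replacement_Clock} \<union>
     range First \<union> range Second \<union> range Leaving \<union> range Arrival"

lemma indep_source_events: "indep_sets source_events sources"
  using mutually_independent unfolding source_events_def[abs_def] sources_def .

lemma Int_stable_source_events: "Int_stable (source_events s)"
  unfolding source_events_def by (rule sets.Int_stable)

abbreviation increment :: "(real \<Rightarrow> 'a \<Rightarrow> nat) \<Rightarrow> (nat \<Rightarrow> real) \<Rightarrow> nat \<Rightarrow> 'a \<Rightarrow> nat" where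
  "increment N u j \<omega> \<equiv> N (u (Suc j)) \<omega> - N (u j) \<omega>"

definition grid :: "(nat \<Rightarrow> real) \<Rightarrow> bool" where
  "grid u \<longleftrightarrow> u 0 = 0 \<and> incseq u"

lemma grid_nonneg: "grid u \<Longrightarrow> 0 \<le> u j"
  unfolding grid_def by (metis incseq_def le0)

lemma grid_Suc: "grid u \<Longrightarrow> u j \<le> u (Suc j)"
  unfolding grid_def by (simp add: incseq_SucD)

text \<open>For the clocks these are literally the families through which
  \<open>indep_vars_def2\<close> expresses independence of the increments, so the clock hypothesis
  applies without conversion.\<close>

definition cell_events :: "(nat \<Rightarrow> real) \<Rightarrow> source \<Rightarrow> nat \<Rightarrow> 'a set set" where
  "cell_events u s j = (case s of
      Gossip_Clock \<Rightarrow> {increment Ng u j -` A \<inter> space M | A. A \<in> sets (count_space UNIV)}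
    | Replacement_Clock \<Rightarrow> {increment Nr u j -` A \<inter> space M | A. A \<in> sets (count_space UNIV)}
    | _ \<Rightarrow> source_events s)"

text \<open>
  The clocks have one family of events per cell \<open>(u j, u (j + 1)]\<close>; all other sources only use the
  dummy index \<open>0\<close>.
\<close>

definition cells :: "(source \<times> nat) set" where
  "cells = Sigma sources (\<lambda>s. if s \<in> {Gossip_Clock, Replacement_Clock} then UNIV else {0})"

lemma Int_stable_cell_events: "Int_stable (cell_events u s j)"
proof -
  have "Int_stable {X -` A \<inter> space M | A. A \<in> sets (count_space UNIV)}" for X :: "'a \<Rightarrow> nat"
  proof (rule Int_stableI, clarsimp)
    fix A B
    show "\<exists>C. X -` A \<inter> space M \<inter> (X -` B \<inter> space M) = X -` C \<inter> space M"
      by (rule exI[of _ "A \<inter> B"]) auto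
  qed
  then show ?thesis
    using Int_stable_source_events by (auto simp: cell_events_def split: source.split)
qed

lemma clock_component_measurable:
  assumes "0 \<le> t"
  shows "N t \<in> measurable (vimage_algebra (space M) (\<lambda>\<omega>. \<lambda>t\<in>{0::real..}. N t \<omega>)
    (PiM {0..} (\<lambda>_. count_space UNIV))) (count_space UNIV)"
proof -
  have "(\<lambda>\<omega>. (\<lambda>t\<in>{0..}. N t \<omega>) t) \<in> measurable (vimage_algebra (space M) (\<lambda>\<omega>. \<lambda>t\<in>{0..}. N t \<omega>)
    (PiM {0..} (\<lambda>_. count_space UNIV))) (count_space UNIV)"
    by (rule measurable_compose[OF measurable_vimage_algebra1 measurable_component_singleton])
      (use assms in \<open>auto simp: space_PiM split: if_splits\<close>)
  with assms show ?thesis by simp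
qed

text \<open>The inner level has content only for the clocks, where it is independence of increments;
  any other source has a single index. An increment is a function of the whole path, which makes the
  cell families subfamilies of the source families.\<close>

lemma indep_cell_events:
  assumes u: "grid u"
  shows "indep_sets (\<lambda>(s, j). cell_events u s j) cells"
  unfolding cells_def
proof (rule indep_sets_refine[OF indep_source_events Int_stable_source_events])
  fix s assume s: "s \<in> sources"
  have clock: "indep_sets (\<lambda>j. {increment N u j -` A \<inter> space M | A. A \<in> sets (count_space UNIV)}) UNIV"
    if "poisson_clock r N" for r N
    using that u unfolding poisson_clock_def grid_def indep_vars_def2 by auto
  have single: "indep_sets (\<lambda>_. source_events s) {0::nat}"
  proof (rule indep_setsI)
    show "source_events s \<subseteq> events"
      using indep_source_events s by (simp add: indep_sets_def)
    fix A and J :: "nat set" assume "J \<noteq> {}" "J \<subseteq> {0}"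
    then have "J = {0}" by auto
    then show "prob (\<Inter>j\<in>J. A j) = (\<Prod>j\<in>J. prob (A j))" by simp
  qed
  show "indep_sets (cell_events u s) (if s \<in> {Gossip_Clock, Replacement_Clock} then UNIV else {0})"
    using clock[OF gossip_clock] clock[OF replacement_clock] single
    by (cases s) (simp_all add: cell_events_def[abs_def])
next
  fix s j
  have "increment N u j -` A \<inter> space M \<in> sets (vimage_algebra (space M) (\<lambda>\<omega>. \<lambda>t\<in>{0..}. N t \<omega>)
    (PiM {0..} (\<lambda>_. count_space UNIV)))" for N :: "real \<Rightarrow> 'a \<Rightarrow> nat" and A
  proof -
    have "increment N u j \<in> measurable (vimage_algebra (space M) (\<lambda>\<omega>. \<lambda>t\<in>{0..}. N t \<omega>)
        (PiM {0..} (\<lambda>_. count_space UNIV))) (count_space UNIV)"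
      by (rule measurable_count_space_binary[where h = "(-)", OF clock_component_measurable
            clock_component_measurable]) (rule grid_nonneg[OF u])+
    from measurable_sets[OF this] show ?thesis by simp
  qed
  then show "cell_events u s j \<subseteq> source_events s"
    by (auto simp: cell_events_def source_events_def split: source.splits)
qed

section \<open>Sigma-algebras generated by sets of cells\<close>

definition hist :: "(nat \<Rightarrow> real) \<Rightarrow> (source \<times> nat) set \<Rightarrow> 'a measure" where
  "hist u J = sigma (space M) (\<Union>p\<in>J. (\<lambda>(s, j). cell_events u s j) p)"

lemma space_hist [simp]: "space (hist u J) = space M"
  by (simp add: hist_def space_measure_of_conv)

lemma cell_events_subset:
  assumes "grid u" "J \<subseteq> cells"
  shows "(\<Union>p\<in>J. (\<lambda>(s, j). cell_events u s j) p) \<subseteq> events"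
  using indep_cell_events[OF assms(1)] assms(2) unfolding indep_sets_def by auto

lemma sets_hist:
  assumes "grid u" "J \<subseteq> cells"
  shows "sets (hist u J) = sigma_sets (space M) (\<Union>p\<in>J. (\<lambda>(s, j). cell_events u s j) p)"
  unfolding hist_def
  by (rule sets_measure_of) (rule order_trans[OF cell_events_subset[OF assms] sets.space_closed])

lemma hist_mono:
  assumes "grid u" "J \<subseteq> K" "K \<subseteq> cells" "f \<in> measurable (hist u J) N"
  shows "f \<in> measurable (hist u K) N"
proof -
  have "sets (hist u J) \<subseteq> sets (hist u K)"
    using assms by (subst (1 2) sets_hist) (auto intro!: sigma_sets_mono')
  then show ?thesis
    using assms(4) by (auto simp: measurable_def)
qed

lemma hist_measurable_M:
  assumes "grid u" "J \<subseteq> cells" "f \<in> measurable (hist u J) N"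
  shows "f \<in> measurable M N"
proof -
  have "sets (hist u J) \<subseteq> events"
    unfolding sets_hist[OF assms(1,2)]
    by (rule sets.sigma_sets_subset[OF cell_events_subset[OF assms(1,2)]])
  then show ?thesis
    using assms(3) by (auto simp: measurable_def)
qed

lemma measurable_histI:
  assumes "grid u" "J \<subseteq> cells" "(s, j) \<in> J" "f \<in> space M \<rightarrow> space N"
    and "\<And>A. A \<in> sets N \<Longrightarrow> f -` A \<inter> space M \<in> cell_events u s j"
  shows "f \<in> measurable (hist u J) N"
proof (rule measurableI)
  fix A assume "A \<in> sets N"
  then show "f -` A \<inter> space (hist u J) \<in> sets (hist u J)"
    unfolding sets_hist[OF assms(1,2)] using assms(3,5) by (auto intro!: sigma_sets.Basic)
qed (use assms(4) in auto)

lemma hist_Initial: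
  assumes "grid u" "J \<subseteq> cells" "(Initial i, 0) \<in> J"
  shows "(\<lambda>\<omega>. x 0 \<omega> i) \<in> borel_measurable (hist u J)"
  by (rule measurable_histI[OF assms])
    (auto simp: cell_events_def source_events_def intro: in_vimage_algebra)

lemma hist_gossip_increment:
  assumes "grid u" "J \<subseteq> cells" "(Gossip_Clock, j) \<in> J"
  shows "increment Ng u j \<in> measurable (hist u J) (count_space UNIV)"
  by (rule measurable_histI[OF assms]) (auto simp: cell_events_def)

lemma hist_replacement_increment:
  assumes "grid u" "J \<subseteq> cells" "(Replacement_Clock, j) \<in> J"
  shows "increment Nr u j \<in> measurable (hist u J) (count_space UNIV)"
  by (rule measurable_histI[OF assms]) (auto simp: cell_events_def)

lemma hist_First:
  assumes "grid u" "J \<subseteq> cells" "(First k, 0) \<in> J"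
  shows "a k \<in> measurable (hist u J) (count_space UNIV)"
  by (rule measurable_histI[OF assms])
    (auto simp: cell_events_def source_events_def intro: in_vimage_algebra)

lemma hist_Second:
  assumes "grid u" "J \<subseteq> cells" "(Second k, 0) \<in> J"
  shows "b k \<in> measurable (hist u J) (count_space UNIV)"
  by (rule measurable_histI[OF assms])
    (auto simp: cell_events_def source_events_def intro: in_vimage_algebra)

lemma hist_Leaving:
  assumes "grid u" "J \<subseteq> cells" "(Leaving k, 0) \<in> J"
  shows "c k \<in> measurable (hist u J) (count_space UNIV)"
  by (rule measurable_histI[OF assms])
    (auto simp: cell_events_def source_events_def intro: in_vimage_algebra)

lemma hist_Arrival:
  assumes "grid u" "J \<subseteq> cells" "(Arrival k, 0) \<in> J"
  shows "z k \<in> borel_measurable (hist u J)"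
  by (rule measurable_histI[OF assms])
    (auto simp: cell_events_def source_events_def intro: in_vimage_algebra)

lemma hist_expectation_mult:
  fixes f g :: "'a \<Rightarrow> real"
  assumes "grid u" "J \<subseteq> cells" "K \<subseteq> cells" "J \<inter> K = {}"
    and "f \<in> borel_measurable (hist u J)" "integrable M f"
    and "g \<in> borel_measurable (hist u K)" "integrable M g"
  shows "integrable M (\<lambda>\<omega>. f \<omega> * g \<omega>)"
    and "expectation (\<lambda>\<omega>. f \<omega> * g \<omega>) = expectation f * expectation g"
  using indep_sets_expectation_mult[OF indep_cell_events[OF assms(1)] _ assms(2-4) _ assms(6) _ assms(8)]
    Int_stable_cell_events assms(5,7) unfolding hist_def by auto

text \<open>All that can influence the state at \<open>u m\<close> once \<open>k\<close> gossips and
  \<open>l\<close> replacements have occurred. Draws are numbered from \<open>0\<close>, so those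
  numbered \<open>k\<close> and \<open>l\<close> stay outside and are free for the next
  activation.\<close>

definition past :: "nat \<Rightarrow> nat \<Rightarrow> nat \<Rightarrow> (source \<times> nat) set" where
  "past k l m = (Initial ` {..<n} \<union> First ` {..<k} \<union> Second ` {..<k} \<union> Leaving ` {..<l} \<union> Arrival ` {..<l}) \<times> {0}
     \<union> {Gossip_Clock, Replacement_Clock} \<times> {..<m}"

lemma past_cells: "past k l m \<subseteq> cells"
  by (auto simp: past_def cells_def sources_def)

lemma past_mono: "k \<le> k' \<Longrightarrow> l \<le> l' \<Longrightarrow> m \<le> m' \<Longrightarrow> past k l m \<subseteq> past k' l' m'"
  unfolding past_def by (intro Un_mono Sigma_mono image_mono) auto

end

section \<open>The state as a function of the past\<close>

lemma measurable_gossip: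
  assumes p: "p \<in> measurable N (count_space UNIV)" and q: "q \<in> measurable N (count_space UNIV)"
    and v: "\<And>i. (\<lambda>\<omega>. v \<omega> i) \<in> borel_measurable N"
  shows "(\<lambda>\<omega>. gossip (p \<omega>) (q \<omega>) (v \<omega>) i) \<in> borel_measurable N"
proof -
  have "(\<lambda>\<omega>. gossip j k (v \<omega>) i) \<in> borel_measurable N" for j k
    using v unfolding gossip_def by (cases "i = k"; cases "i = j") simp_all
  then have "(\<lambda>\<omega>. gossip j (q \<omega>) (v \<omega>) i) \<in> borel_measurable N" for j
    by (rule measurable_compose_countable[OF _ q])
  then show ?thesis
    by (rule measurable_compose_countable[OF _ p])
qed

lemma measurable_replacement:
  assumes p: "p \<in> measurable N (count_space UNIV)" and z: "z \<in> borel_measurable N"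
    and v: "\<And>i. (\<lambda>\<omega>. v \<omega> i) \<in> borel_measurable N"
  shows "(\<lambda>\<omega>. replacement (p \<omega>) (z \<omega>) (v \<omega>) i) \<in> borel_measurable N"
proof -
  have "(\<lambda>\<omega>. replacement j (z \<omega>) (v \<omega>) i) \<in> borel_measurable N" for j
    using v z unfolding replacement_def by (cases "i = j") simp_all
  then show ?thesis
    by (rule measurable_compose_countable[OF _ p])
qed

context gossip_dynamics
begin

section \<open>Almost sure bounds and the dynamics over one cell\<close>

definition bound :: real where
  "bound = (SOME B. 0 \<le> B \<and> (AE y in D. \<bar>y\<bar> \<le> B))"

lemma bound_nonneg: "0 \<le> bound" and AE_D_bound: "AE y in D. \<bar>y\<bar> \<le> bound"
proof -
  obtain B where "AE y in D. \<bar>y\<bar> \<le> B"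
    using D_bounded_support by auto
  then have "AE y in D. \<bar>y\<bar> \<le> max B 0"
    by eventually_elim simp
  then have "\<exists>B. 0 \<le> B \<and> (AE y in D. \<bar>y\<bar> \<le> B)"
    by (intro exI[of _ "max B 0"]) simp
  then have "0 \<le> bound \<and> (AE y in D. \<bar>y\<bar> \<le> bound)"
    unfolding bound_def by (rule someI_ex)
  then show "0 \<le> bound" "AE y in D. \<bar>y\<bar> \<le> bound" by auto
qed

lemma AE_bound_of_distr:
  assumes "random_variable borel f" "distr M borel f = D"
  shows "AE \<omega> in M. \<bar>f \<omega>\<bar> \<le> bound"
  using AE_D_bound unfolding assms(2)[symmetric] by (subst (asm) AE_distr_iff) (use assms(1) in auto)

lemma AE_arrivals_bound: "AE \<omega> in M. \<forall>k. \<bar>z k \<omega>\<bar> \<le> bound"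
  unfolding AE_all_countable by (intro allI AE_bound_of_distr z_measurable z_distributed)

lemma AE_initial_bound: "AE \<omega> in M. \<forall>i<n. \<bar>x 0 \<omega> i\<bar> \<le> bound"
proof -
  have "AE \<omega> in M. i < n \<longrightarrow> \<bar>x 0 \<omega> i\<bar> \<le> bound" for i
    using AE_bound_of_distr[OF x_measurable initial_distributed, of i] by (cases "i < n") auto
  then show ?thesis
    by (simp add: AE_all_countable)
qed

lemma AE_agents: "AE \<omega> in M. \<forall>k. a k \<omega> < n \<and> b k \<omega> < n \<and> c k \<omega> < n"
proof -
  have *: "AE \<omega> in M. f \<omega> < n" if "random_variable (count_space UNIV) f"
    "distr M (count_space UNIV) f = measure_pmf (pmf_of_set {..<n})" for f
  proof -
    have "AE i in measure_pmf (pmf_of_set {..<n}). i < n"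
      using n_pos by (subst AE_measure_pmf_iff) (auto simp: set_pmf_of_set lessThan_empty_iff)
    then show ?thesis
      unfolding that(2)[symmetric] by (subst (asm) AE_distr_iff) (use that(1) in auto)
  qed
  show ?thesis
    unfolding AE_all_countable
    using *[OF a_measurable a_uniform] *[OF b_measurable b_uniform] *[OF c_measurable c_uniform]
    by (intro allI AE_conjI)
qed

lemma AE_start: "AE \<omega> in M. Ng 0 \<omega> = 0 \<and> Nr 0 \<omega> = 0"
  using gossip_clock replacement_clock unfolding poisson_clock_def by auto

lemma AE_transition:
  assumes "0 \<le> s" "s \<le> t"
  shows "AE \<omega> in M.
    (Ng t \<omega> - Ng s \<omega> = 0 \<longrightarrow> Nr t \<omega> - Nr s \<omega> = 0 \<longrightarrow> (\<forall>i<n. x t \<omega> i = x s \<omega> i)) \<and>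
    (Ng t \<omega> - Ng s \<omega> = 1 \<longrightarrow> Nr t \<omega> - Nr s \<omega> = 0 \<longrightarrow>
      (\<forall>i<n. x t \<omega> i = gossip (a (Ng s \<omega>) \<omega>) (b (Ng s \<omega>) \<omega>) (x s \<omega>) i)) \<and>
    (Ng t \<omega> - Ng s \<omega> = 0 \<longrightarrow> Nr t \<omega> - Nr s \<omega> = 1 \<longrightarrow>
      (\<forall>i<n. x t \<omega> i = replacement (c (Nr s \<omega>) \<omega>) (z (Nr s \<omega>) \<omega>) (x s \<omega>) i))"
proof (cases "s = t")
  case True
  then show ?thesis by simp
next
  case False
  with assms have st: "s < t" by simp
  show ?thesis
    using no_activation gossip_activation replacement_activation
      poisson_clock_mono[OF gossip_clock] poisson_clock_mono[OF replacement_clock]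
  proof eventually_elim
    case (elim \<omega>)
    have le: "Ng s \<omega> \<le> Ng t \<omega>" "Nr s \<omega> \<le> Nr t \<omega>"
      using elim(4,5) assms by auto
    have "Ng t \<omega> - Ng s \<omega> = 0 \<Longrightarrow> Ng t \<omega> = Ng s \<omega>" "Nr t \<omega> - Nr s \<omega> = 0 \<Longrightarrow> Nr t \<omega> = Nr s \<omega>"
      "Ng t \<omega> - Ng s \<omega> = 1 \<Longrightarrow> Ng t \<omega> = Suc (Ng s \<omega>)" "Nr t \<omega> - Nr s \<omega> = 1 \<Longrightarrow> Nr t \<omega> = Suc (Nr s \<omega>)"
      using le by auto
    with elim(1-3)[rule_format, OF assms(1) st] show ?case by blast
  qed
qed

definition tame :: "(nat \<Rightarrow> real) \<Rightarrow> nat \<Rightarrow> 'a \<Rightarrow> bool" where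
  "tame u m \<omega> \<longleftrightarrow> (\<forall>j<m. increment Ng u j \<omega> + increment Nr u j \<omega> \<le> 1)"

lemma tame_cases:
  assumes "tame u (Suc m) \<omega>"
  obtains "tame u m \<omega>" "increment Ng u m \<omega> = 0" "increment Nr u m \<omega> = 0"
  | "tame u m \<omega>" "increment Ng u m \<omega> = 1" "increment Nr u m \<omega> = 0"
  | "tame u m \<omega>" "increment Ng u m \<omega> = 0" "increment Nr u m \<omega> = 1"
proof -
  have "tame u m \<omega>" "increment Ng u m \<omega> + increment Nr u m \<omega> \<le> 1"
    using assms by (auto simp: tame_def)
  with that show thesis by linarith
qed

text \<open>The interval from \<open>- bound\<close> to \<open>bound\<close> almost surely contains
  the initial values and the arrivals and is closed under averaging, so no transition over a cell
  with at most one activation leaves it.\<close>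

lemma AE_bounded_on_tame:
  assumes u: "grid u"
  shows "AE \<omega> in M. tame u m \<omega> \<longrightarrow> (\<forall>i<n. \<bar>x (u m) \<omega> i\<bar> \<le> bound)"
proof (induction m)
  case 0
  show ?case
    using AE_initial_bound u by (auto simp: grid_def)
next
  case (Suc m)
  from Suc AE_agents AE_arrivals_bound AE_transition[OF grid_nonneg[OF u] grid_Suc[OF u], of m]
  show ?case
  proof eventually_elim
    case (elim \<omega>)
    show ?case
    proof
      assume tame: "tame u (Suc m) \<omega>"
      then have IH: "\<bar>x (u m) \<omega> i\<bar> \<le> bound" if "i < n" for i
        using elim(1) that by (auto simp: tame_def)
      from tame show "\<forall>i<n. \<bar>x (u (Suc m)) \<omega> i\<bar> \<le> bound"
      proof (cases rule: tame_cases)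
        case 1
        with elim(4) IH show ?thesis by auto
      next
        case 2
        let ?p = "a (Ng (u m) \<omega>) \<omega>" and ?q = "b (Ng (u m) \<omega>) \<omega>"
        have "\<bar>(x (u m) \<omega> ?p + x (u m) \<omega> ?q) / 2\<bar> \<le> bound"
          using IH[of ?p] IH[of ?q] elim(2) by (auto simp: abs_le_iff field_simps)
        with 2 elim(4) IH show ?thesis by (auto simp: gossip_def)
      next
        case 3
        with elim(3,4) IH show ?thesis by (auto simp: replacement_def)
      qed
    qed
  qed
qed

text \<open>The induction runs over the cells for all counts at once: the cell before a state with
  counts \<open>(k, l)\<close> starts with counts \<open>(k, l)\<close>, \<open>(k - 1, l)\<close>
  or \<open>(k, l - 1)\<close>. Fixing the final counts makes the indices of all draws
  deterministic, which is what confines \<open>y\<close> to \<open>past k l m\<close>.\<close>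

lemma state_measurable_past:
  assumes u: "grid u"
  shows "\<exists>y. (\<forall>i. (\<lambda>\<omega>. y \<omega> i) \<in> borel_measurable (hist u (past k l m))) \<and>
    (AE \<omega> in M. tame u m \<omega> \<longrightarrow> Ng (u m) \<omega> = k \<longrightarrow> Nr (u m) \<omega> = l \<longrightarrow>
      (\<forall>i<n. x (u m) \<omega> i = y \<omega> i))"
proof (induction m arbitrary: k l)
  case 0
  define y where "y \<omega> i = (if i < n then x 0 \<omega> i else 0)" for \<omega> i
  have "(\<lambda>\<omega>. y \<omega> i) \<in> borel_measurable (hist u (past k l 0))" for i
  proof (cases "i < n")
    case True
    then have "(\<lambda>\<omega>. x 0 \<omega> i) \<in> borel_measurable (hist u (past k l 0))"
      by (intro hist_Initial[OF u past_cells]) (auto simp: past_def)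
    with True show ?thesis by (simp add: y_def)
  qed (simp add: y_def)
  moreover have "x (u 0) \<omega> i = y \<omega> i" if "i < n" for \<omega> i
    using u that by (simp add: y_def grid_def)
  ultimately show ?case by (intro exI[of _ y]) auto
next
  case (Suc m)
  let ?H = "hist u (past k l (Suc m))"
  \<comment> \<open>One function is fixed for every pair of counts, since up to three of them are
    combined below.\<close>
  define Y where "Y k l = (SOME y. (\<forall>i. (\<lambda>\<omega>. y \<omega> i) \<in> borel_measurable (hist u (past k l m))) \<and>
    (AE \<omega> in M. tame u m \<omega> \<longrightarrow> Ng (u m) \<omega> = k \<longrightarrow> Nr (u m) \<omega> = l \<longrightarrow>
      (\<forall>i<n. x (u m) \<omega> i = y \<omega> i)))" for k l
  have "(\<forall>i. (\<lambda>\<omega>. Y k l \<omega> i) \<in> borel_measurable (hist u (past k l m))) \<and>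
    (AE \<omega> in M. tame u m \<omega> \<longrightarrow> Ng (u m) \<omega> = k \<longrightarrow> Nr (u m) \<omega> = l \<longrightarrow>
      (\<forall>i<n. x (u m) \<omega> i = Y k l \<omega> i))" for k l
    unfolding Y_def by (rule someI_ex[OF Suc.IH])
  then have
    Y_meas: "\<And>k l i. (\<lambda>\<omega>. Y k l \<omega> i) \<in> borel_measurable (hist u (past k l m))"
    and Y_eq: "\<And>k l. AE \<omega> in M. tame u m \<omega> \<longrightarrow> Ng (u m) \<omega> = k \<longrightarrow> Nr (u m) \<omega> = l \<longrightarrow>
      (\<forall>i<n. x (u m) \<omega> i = Y k l \<omega> i)"
    by simp_all
  have Y: "(\<lambda>\<omega>. Y k' l' \<omega> i) \<in> borel_measurable ?H" if "k' \<le> k" "l' \<le> l" for k' l' i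
    by (rule hist_mono[OF u past_mono past_cells Y_meas]) (use that in auto)
  \<comment> \<open>The last of \<open>k\<close> gossips carries the number \<open>k - 1\<close>.
    For \<open>k = 0\<close> the last cell cannot contain a gossip, and the value \<open>0\<close>
    keeps out the draw \<open>a 0\<close>, which \<open>past 0 l (Suc m)\<close> lacks. The same
    holds for \<open>R\<close> and \<open>l\<close>.\<close>
  define G where "G \<omega> = (if k = 0 then (\<lambda>_. 0) else gossip (a (k - 1) \<omega>) (b (k - 1) \<omega>) (Y (k - 1) l \<omega>))" for \<omega>
  define R where "R \<omega> = (if l = 0 then (\<lambda>_. 0) else replacement (c (l - 1) \<omega>) (z (l - 1) \<omega>) (Y k (l - 1) \<omega>))" for \<omega>
  have G: "(\<lambda>\<omega>. G \<omega> i) \<in> borel_measurable ?H" for i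
  proof (cases "k = 0")
    case False
    then have "a (k - 1) \<in> measurable ?H (count_space UNIV)" "b (k - 1) \<in> measurable ?H (count_space UNIV)"
      by (intro hist_First hist_Second u past_cells; simp add: past_def)+
    with False show ?thesis
      unfolding G_def by (simp add: measurable_gossip Y)
  qed (simp add: G_def)
  have R: "(\<lambda>\<omega>. R \<omega> i) \<in> borel_measurable ?H" for i
  proof (cases "l = 0")
    case False
    then have "c (l - 1) \<in> measurable ?H (count_space UNIV)" "z (l - 1) \<in> borel_measurable ?H"
      by (intro hist_Leaving hist_Arrival u past_cells; simp add: past_def)+
    with False show ?thesis
      unfolding R_def by (simp add: measurable_replacement Y)
  qed (simp add: R_def)
  have inc[measurable]: "increment Ng u m \<in> measurable ?H (count_space UNIV)"
    "increment Nr u m \<in> measurable ?H (count_space UNIV)"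
    by (intro hist_gossip_increment hist_replacement_increment u past_cells; simp add: past_def)+
  \<comment> \<open>The increments over the last cell belong to the past and tell which transition
    led to the counts \<open>k\<close> and \<open>l\<close>.\<close>
  define y where "y \<omega> i =
    (if increment Nr u m \<omega> = 0 then if increment Ng u m \<omega> = 0 then Y k l \<omega> i else G \<omega> i else R \<omega> i)" for \<omega> i
  have "(\<lambda>\<omega>. y \<omega> i) \<in> borel_measurable ?H" for i
    unfolding y_def using Y G R by measurable
  moreover have "AE \<omega> in M. tame u (Suc m) \<omega> \<longrightarrow> Ng (u (Suc m)) \<omega> = k \<longrightarrow> Nr (u (Suc m)) \<omega> = l \<longrightarrow>
      (\<forall>i<n. x (u (Suc m)) \<omega> i = y \<omega> i)"
    using Y_eq[of k l] Y_eq[of "k - 1" l] Y_eq[of k "l - 1"] AE_agents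
      AE_transition[OF grid_nonneg[OF u] grid_Suc[OF u], of m]
      poisson_clock_mono[OF gossip_clock] poisson_clock_mono[OF replacement_clock]
  proof eventually_elim
    case (elim \<omega>)
    have le: "Ng (u m) \<omega> \<le> Ng (u (Suc m)) \<omega>" "Nr (u m) \<omega> \<le> Nr (u (Suc m)) \<omega>"
      using elim(6,7) grid_nonneg[OF u] grid_Suc[OF u] by auto
    show ?case
    proof (intro impI)
      assume tame: "tame u (Suc m) \<omega>" and k: "Ng (u (Suc m)) \<omega> = k" and l: "Nr (u (Suc m)) \<omega> = l"
      from tame show "\<forall>i<n. x (u (Suc m)) \<omega> i = y \<omega> i"
      proof (cases rule: tame_cases)
        case 1
        with le k l have "Ng (u m) \<omega> = k" "Nr (u m) \<omega> = l" by auto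
        with 1 elim(1,5) show ?thesis by (simp add: y_def)
      next
        case 2
        with le k l have kl: "Ng (u m) \<omega> = k - 1" "Nr (u m) \<omega> = l" "k \<noteq> 0" by auto
        with 2 elim(2,5) have "\<forall>i<n. x (u m) \<omega> i = Y (k - 1) l \<omega> i"
          "\<forall>i<n. x (u (Suc m)) \<omega> i = gossip (a (k - 1) \<omega>) (b (k - 1) \<omega>) (x (u m) \<omega>) i" by auto
        with 2 kl elim(4) show ?thesis by (simp add: y_def G_def gossip_def)
      next
        case 3
        with le k l have kl: "Ng (u m) \<omega> = k" "Nr (u m) \<omega> = l - 1" "l \<noteq> 0" by auto
        with 3 elim(3,5) have "\<forall>i<n. x (u m) \<omega> i = Y k (l - 1) \<omega> i"
          "\<forall>i<n. x (u (Suc m)) \<omega> i = replacement (c (l - 1) \<omega>) (z (l - 1) \<omega>) (x (u m) \<omega>) i" by auto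
        with 3 kl show ?thesis by (simp add: y_def R_def replacement_def)
      qed
    qed
  qed
  ultimately show ?case by (intro exI[of _ y]) auto
qed

end

section \<open>Probability of several activations\<close>

lemma (in prob_space) expectation_diff_le:
  fixes F G :: "'a \<Rightarrow> real"
  assumes "integrable M F" "integrable M G" "A \<in> events"
    and "AE \<omega> in M. \<bar>F \<omega> - G \<omega>\<bar> \<le> C * indicator A \<omega>"
  shows "\<bar>expectation F - expectation G\<bar> \<le> C * prob A"
proof -
  have "\<bar>expectation F - expectation G\<bar> = \<bar>expectation (\<lambda>\<omega>. F \<omega> - G \<omega>)\<bar>"
    using assms by simp
  also have "\<dots> \<le> expectation (\<lambda>\<omega>. \<bar>F \<omega> - G \<omega>\<bar>)"
    by (rule integral_abs_bound)
  also have "\<dots> \<le> expectation (\<lambda>\<omega>. C * indicator A \<omega>)"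
    using assms by (intro integral_mono_AE) (auto intro!: integrable_mult_right simp: emeasure_finite less_top[symmetric])
  also have "\<dots> = C * prob A"
    using assms(3) by (simp add: Int_absorb1 sets.sets_into_space)
  finally show ?thesis .
qed

text \<open>The level sets of \<open>X\<close> form a countable partition, and the expectation of an
  integrable function is the sum of its integrals over the pieces.\<close>

lemma (in prob_space) expectation_eq_by_value:
  fixes F G :: "'a \<Rightarrow> real" and X :: "'a \<Rightarrow> nat"
  assumes F: "integrable M F" and G: "integrable M G" and X: "random_variable (count_space UNIV) X"
    and eq: "\<And>p. expectation (\<lambda>\<omega>. F \<omega> * indicator {p} (X \<omega>)) = expectation (\<lambda>\<omega>. G \<omega> * indicator {p} (X \<omega>))"
  shows "expectation F = expectation G"
proof -
  define A where "A p = X -` {p} \<inter> space M" for p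
  have A: "A p \<in> events" for p
    unfolding A_def using X by simp
  have Un: "(\<Union>p. A p) = space M"
    by (auto simp: A_def)
  have sum: "expectation H = (\<Sum>p. expectation (\<lambda>\<omega>. H \<omega> * indicator {p} (X \<omega>)))"
    if "integrable M H" for H :: "'a \<Rightarrow> real"
  proof -
    have "expectation H = (LINT \<omega>:(\<Union>p. A p)|M. H \<omega>)"
      unfolding Un set_lebesgue_integral_def by (intro Bochner_Integration.integral_cong) auto
    also have "\<dots> = (\<Sum>p. LINT \<omega>:A p|M. H \<omega>)"
    proof (rule lebesgue_integral_countable_add[OF A])
      show "set_integrable M (\<Union>p. A p) H"
        unfolding Un set_integrable_def using that by (rule integrable_mult_indicator[OF sets.top])
    qed (auto simp: A_def)
    also have "(\<lambda>p. LINT \<omega>:A p|M. H \<omega>) = (\<lambda>p. expectation (\<lambda>\<omega>. H \<omega> * indicator {p} (X \<omega>)))"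
      unfolding set_lebesgue_integral_def
      by (intro ext Bochner_Integration.integral_cong) (auto simp: A_def indicator_def)
    finally show ?thesis .
  qed
  show ?thesis
    unfolding sum[OF F] sum[OF G] eq ..
qed

lemma (in prob_space) expectation_indicator_comp:
  assumes "random_variable N X" "A \<in> sets N"
  shows "expectation (\<lambda>\<omega>. indicat_real A (X \<omega>)) = prob (X -` A \<inter> space M)"
proof -
  have "expectation (\<lambda>\<omega>. indicat_real A (X \<omega>)) = expectation (indicat_real (X -` A \<inter> space M))"
    by (intro Bochner_Integration.integral_cong) (auto simp: indicator_def)
  also have "\<dots> = prob (X -` A \<inter> space M)"
    using assms by (simp add: Int_absorb2)
  finally show ?thesis .
qed

lemma nonpos_of_le_inverse_nat:
  fixes r K :: real
  assumes "\<And>m::nat. 0 < m \<Longrightarrow> r \<le> K / real m"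
  shows "r \<le> 0"
proof (rule tendsto_lowerbound)
  show "(\<lambda>m. K / real m) \<longlonglongrightarrow> 0"
    by (rule lim_const_over_n)
  show "\<forall>\<^sub>F m in sequentially. r \<le> K / real m"
    using eventually_gt_at_top[of "0::nat"] by eventually_elim (rule assms)
qed simp

text \<open>The left side is the probability that a Poisson variable of mean \<open>y\<close> is at
  least two; \<open>1 - y \<le> exp (- y)\<close> makes it quadratic in \<open>y\<close>.\<close>

lemma one_minus_exp_le_square:
  fixes y :: real
  assumes "0 \<le> y"
  shows "1 - exp (- y) * (1 + y) \<le> y\<^sup>2"
proof -
  have "(1 - y) * (1 + y) \<le> exp (- y) * (1 + y)"
    using exp_ge_add_one_self[of "- y"] assms by (intro mult_right_mono) auto
  then show ?thesis
    by (simp add: algebra_simps power2_eq_square)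
qed

text \<open>At \<open>y = 0\<close> the convention \<open>0 ^ 0 = 1\<close> makes this the point
  mass at \<open>0\<close>, which covers clocks of rate \<open>0\<close> and empty cells.\<close>

definition poisson_mass :: "real \<Rightarrow> nat \<Rightarrow> real" where
  "poisson_mass y k = y ^ k / fact k * exp (- y)"

text \<open>The points \<open>0, s/m, \<dots>, s\<close> followed by \<open>s + h\<close>, so that cell \<open>m\<close> is the window \<open>(s, s + h]\<close>.\<close>

definition step_grid :: "real \<Rightarrow> real \<Rightarrow> nat \<Rightarrow> nat \<Rightarrow> real" where
  "step_grid s h m j = (if j \<le> m then s * real j / real m else s + h)"

lemma step_grid_at [simp]: "0 < m \<Longrightarrow> step_grid s h m m = s" "step_grid s h m (Suc m) = s + h"
  by (simp_all add: step_grid_def)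

lemma step_grid_diff: "j < m \<Longrightarrow> step_grid s h m (Suc j) - step_grid s h m j = s / real m"
  by (simp add: step_grid_def field_simps)

context gossip_dynamics
begin

lemma grid_step_grid:
  assumes "0 \<le> s" "0 \<le> h" "0 < m"
  shows "grid (step_grid s h m)"
  unfolding grid_def
proof
  show "incseq (step_grid s h m)"
  proof (rule incseq_SucI)
    fix j
    consider "j < m" | "j = m" | "m < j" by linarith
    then show "step_grid s h m j \<le> step_grid s h m (Suc j)"
    proof cases
      case 1
      have "0 \<le> s / real m" using assms by simp
      with step_grid_diff[OF 1, of s h] show ?thesis by linarith
    next
      case 2
      with assms show ?thesis by simp
    next
      case 3
      then show ?thesis by (simp add: step_grid_def)
    qed
  qed
qed (simp add: step_grid_def)

text \<open>The rate of the superposed clock that counts activations of either kind.\<close>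

definition rate :: real where
  "rate = real n * (lam_g + lam_r)"

lemma rate_nonneg: "0 \<le> rate"
  using lam_g_nonneg lam_r_nonneg by (simp add: rate_def)

lemma Ng_measurable: "0 \<le> t \<Longrightarrow> random_variable (count_space UNIV) (Ng t)"
  and Nr_measurable: "0 \<le> t \<Longrightarrow> random_variable (count_space UNIV) (Nr t)"
  using gossip_clock replacement_clock by (auto simp: poisson_clock_def)

lemma increment_measurable:
  assumes "grid u"
  shows "random_variable (count_space UNIV) (increment Ng u m)"
    and "random_variable (count_space UNIV) (increment Nr u m)"
  using grid_nonneg[OF assms] Ng_measurable Nr_measurable
  by (auto intro!: measurable_count_space_binary[where h = "(-)"])

lemma clock_cells: "(Gossip_Clock, m) \<in> cells" "(Replacement_Clock, m) \<in> cells"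
  by (auto simp: cells_def sources_def)

lemma integrable_indicator_comp:
  assumes "random_variable N X" "A \<in> sets N"
  shows "integrable M (\<lambda>\<omega>. indicat_real A (X \<omega>))"
  by (rule integrable_const_bound[of _ 1])
    (use measurable_compose[OF assms(1) borel_measurable_indicator[OF assms(2)]] in \<open>auto simp: indicator_def\<close>)

lemma poisson_clock_increment:
  assumes "poisson_clock r N" "random_variable (count_space UNIV) (increment N u m)" "grid u"
  shows "expectation (\<lambda>\<omega>. indicat_real {k} (increment N u m \<omega>)) = poisson_mass (r * (u (Suc m) - u m)) k"
proof -
  have "increment N u m -` {k} \<inter> space M = {\<omega> \<in> space M. N (u (Suc m)) \<omega> - N (u m) \<omega> = k}"
    by auto
  then show ?thesis
    using expectation_indicator_comp[OF assms(2), of "{k}"] assms(1)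
      grid_nonneg[OF assms(3), of m] grid_Suc[OF assms(3), of m]
    by (simp add: poisson_clock_def poisson_mass_def)
qed

lemma expectation_increments:
  assumes u: "grid u"
  shows "expectation (\<lambda>\<omega>. indicator {i} (increment Ng u m \<omega>) * indicator {j} (increment Nr u m \<omega>)) =
    poisson_mass (real n * lam_g * (u (Suc m) - u m)) i * poisson_mass (real n * lam_r * (u (Suc m) - u m)) j"
proof -
  have sub: "{(Gossip_Clock, m)} \<subseteq> cells" "{(Replacement_Clock, m)} \<subseteq> cells"
    using clock_cells by auto
  have "expectation (\<lambda>\<omega>. indicat_real {i} (increment Ng u m \<omega>) * indicator {j} (increment Nr u m \<omega>)) =
      expectation (\<lambda>\<omega>. indicat_real {i} (increment Ng u m \<omega>)) * expectation (\<lambda>\<omega>. indicat_real {j} (increment Nr u m \<omega>))"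
  proof (rule hist_expectation_mult(2)[OF u sub])
    show "(\<lambda>\<omega>. indicat_real {i} (increment Ng u m \<omega>)) \<in> borel_measurable (hist u {(Gossip_Clock, m)})"
      by (rule measurable_compose[OF hist_gossip_increment[OF u sub(1)]]) auto
    show "(\<lambda>\<omega>. indicat_real {j} (increment Nr u m \<omega>)) \<in> borel_measurable (hist u {(Replacement_Clock, m)})"
      by (rule measurable_compose[OF hist_replacement_increment[OF u sub(2)]]) auto
    show "integrable M (\<lambda>\<omega>. indicat_real {i} (increment Ng u m \<omega>))"
      by (rule integrable_indicator_comp[OF increment_measurable(1)[OF u]]) simp
    show "integrable M (\<lambda>\<omega>. indicat_real {j} (increment Nr u m \<omega>))"
      by (rule integrable_indicator_comp[OF increment_measurable(2)[OF u]]) simp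
  qed simp
  then show ?thesis
    unfolding poisson_clock_increment[OF gossip_clock increment_measurable(1)[OF u] u]
      poisson_clock_increment[OF replacement_clock increment_measurable(2)[OF u] u] .
qed

lemma multiple_activations_event:
  assumes "grid u"
  shows "{\<omega> \<in> space M. \<not> increment Ng u m \<omega> + increment Nr u m \<omega> \<le> 1} \<in> events"
proof -
  have "{\<omega> \<in> space M. \<not> increment Ng u m \<omega> + increment Nr u m \<omega> \<le> 1} =
    (\<lambda>\<omega>. increment Ng u m \<omega> + increment Nr u m \<omega>) -` {2..} \<inter> space M"
    by auto
  also have "\<dots> \<in> events"
    by (rule measurable_sets[OF measurable_count_space_binary[where h = "(+)", OF increment_measurable[OF assms]]]) simp
  finally show ?thesis .
qed

lemma prob_multiple_activations:
  assumes u: "grid u"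
  shows "prob {\<omega> \<in> space M. \<not> increment Ng u m \<omega> + increment Nr u m \<omega> \<le> 1} \<le> (rate * (u (Suc m) - u m))\<^sup>2"
proof -
  let ?U = "increment Ng u m" and ?V = "increment Nr u m" and ?d = "u (Suc m) - u m"
  define I where "I i j \<omega> = indicat_real {i} (?U \<omega>) * indicator {j} (?V \<omega>)" for i j \<omega>
  note [measurable] = increment_measurable[OF u, of m]
  define A where "A = {\<omega> \<in> space M. \<not> ?U \<omega> + ?V \<omega> \<le> 1}"
  have A: "A \<in> events"
    unfolding A_def by (rule multiple_activations_event[OF u])
  have int: "integrable M (I i j)" for i j
  proof (rule integrable_const_bound[of _ 1])
    show "random_variable borel (I i j)"
      unfolding I_def by (intro borel_measurable_times;
        rule measurable_compose[OF increment_measurable(1)[OF u]] measurable_compose[OF increment_measurable(2)[OF u]]; simp)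
  qed (auto simp: I_def indicator_def)
  have EI: "expectation (I i j) = poisson_mass (real n * lam_g * ?d) i * poisson_mass (real n * lam_r * ?d) j" for i j
    unfolding I_def by (rule expectation_increments[OF u])
  have "prob A = expectation (indicat_real A)"
    using A by (simp add: Int_absorb1 sets.sets_into_space)
  \<comment> \<open>At most one activation means one of three exclusive patterns. Their masses add
    up to \<open>exp (- y) * (1 + y)\<close> with \<open>y = rate * ?d\<close>, as for one Poisson
    variable of the combined rate.\<close>
  also have "\<dots> = expectation (\<lambda>\<omega>. 1 - I 0 0 \<omega> - I 1 0 \<omega> - I 0 1 \<omega>)"
  proof (intro Bochner_Integration.integral_cong refl)
    fix \<omega> assume "\<omega> \<in> space M"
    then show "indicat_real A \<omega> = 1 - I 0 0 \<omega> - I 1 0 \<omega> - I 0 1 \<omega>"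
      by (cases "?U \<omega>"; cases "?U \<omega> - 1"; cases "?V \<omega>"; cases "?V \<omega> - 1")
        (auto simp: A_def I_def indicator_def)
  qed
  also have "\<dots> = 1 - expectation (I 0 0) - expectation (I 1 0) - expectation (I 0 1)"
    using int by (simp add: prob_space)
  also have "\<dots> = 1 - exp (- (rate * ?d)) * (1 + rate * ?d)"
    unfolding EI poisson_mass_def rate_def
    by (simp add: algebra_simps exp_add exp_minus exp_diff divide_simps)
  also have "\<dots> \<le> (rate * ?d)\<^sup>2"
    using rate_nonneg grid_Suc[OF u, of m] by (intro one_minus_exp_le_square) auto
  finally show ?thesis by (simp add: A_def)
qed

lemma tame_measurable: "grid u \<Longrightarrow> {\<omega> \<in> space M. \<not> tame u m \<omega>} \<in> events"
proof -
  assume u: "grid u"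
  have "{\<omega> \<in> space M. \<not> tame u m \<omega>} =
    (\<Union>j<m. {\<omega> \<in> space M. \<not> increment Ng u j \<omega> + increment Nr u j \<omega> \<le> 1})"
    by (auto simp: tame_def)
  also have "\<dots> \<in> events"
    by (intro sets.finite_UN finite_lessThan multiple_activations_event[OF u])
  finally show ?thesis .
qed

text \<open>A union bound over \<open>m\<close> cells, each bad with probability at most
  \<open>(rate * (s / real m))\<^sup>2\<close>, still leaves one factor
  \<open>1 / real m\<close>.\<close>

lemma prob_not_tame:
  assumes "0 \<le> s" "0 \<le> h" "0 < m"
  shows "prob {\<omega> \<in> space M. \<not> tame (step_grid s h m) m \<omega>} \<le> (rate * s)\<^sup>2 / real m"
proof -
  let ?u = "step_grid s h m"
  note u = grid_step_grid[OF assms]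
  let ?A = "\<lambda>j. {\<omega> \<in> space M. \<not> increment Ng ?u j \<omega> + increment Nr ?u j \<omega> \<le> 1}"
  have A: "?A j \<in> events" for j
    by (rule multiple_activations_event[OF u])
  have "prob {\<omega> \<in> space M. \<not> tame ?u m \<omega>} = prob (\<Union>j<m. ?A j)"
    by (rule arg_cong[where f = prob]) (auto simp: tame_def)
  also have "\<dots> \<le> (\<Sum>j<m. prob (?A j))"
    by (rule finite_measure_subadditive_finite) (use A in auto)
  also have "\<dots> \<le> (\<Sum>j<m. (rate * (s / real m))\<^sup>2)"
  proof (rule sum_mono)
    fix j assume "j \<in> {..<m}"
    then show "prob (?A j) \<le> (rate * (s / real m))\<^sup>2"
      using prob_multiple_activations[OF u, of j] step_grid_diff[of j m s h] by simp
  qed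
  also have "\<dots> = (rate * s)\<^sup>2 / real m"
    using assms(3) by (simp add: power2_eq_square field_simps)
  finally show ?thesis .
qed

text \<open>Measurability of \<open>x\<close> is assumed only for coordinates below
  \<open>n\<close>, while composing with a function on the full product requires it for all; the
  others are set to \<open>0\<close>.\<close>

definition state :: "real \<Rightarrow> 'a \<Rightarrow> nat \<Rightarrow> real" where
  "state t \<omega> i = (if i < n then x t \<omega> i else 0)"

lemma state_measurable: "0 \<le> t \<Longrightarrow> (\<lambda>\<omega>. state t \<omega> i) \<in> borel_measurable M"
  by (cases "i < n") (simp_all add: state_def x_measurable)

text \<open>The exceptional event does not depend on the grid, yet almost surely it occurs only
  where the grid is not tame. Its probability is thus below every term of a sequence tending to
  \<open>0\<close>. A window of length \<open>0\<close> suffices here, because only the time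
  \<open>s\<close> matters.\<close>

lemma AE_bounded:
  assumes "0 \<le> s"
  shows "AE \<omega> in M. \<forall>i<n. \<bar>x s \<omega> i\<bar> \<le> bound"
proof -
  define A where "A = {\<omega> \<in> space M. \<exists>i\<in>{..<n}. \<not> \<bar>state s \<omega> i\<bar> \<le> bound}"
  note [measurable] = state_measurable[OF assms]
  have A: "A \<in> events"
    unfolding A_def by measurable
  have "prob A \<le> (rate * s)\<^sup>2 / real m" if m: "0 < m" for m
  proof -
    let ?u = "step_grid s 0 m"
    note u = grid_step_grid[OF assms order.refl m]
    have "prob A \<le> prob {\<omega> \<in> space M. \<not> tame ?u m \<omega>}"
    proof (rule finite_measure_mono_AE)
      show "AE \<omega> in M. \<omega> \<in> A \<longrightarrow> \<omega> \<in> {\<omega> \<in> space M. \<not> tame ?u m \<omega>}"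
        using AE_bounded_on_tame[OF u, of m] by eventually_elim (use m in \<open>auto simp: A_def state_def\<close>)
    qed (rule tame_measurable[OF u])
    also have "\<dots> \<le> (rate * s)\<^sup>2 / real m"
      by (rule prob_not_tame[OF assms order.refl m])
    finally show ?thesis .
  qed
  then have "prob A \<le> 0"
    by (rule nonpos_of_le_inverse_nat)
  then have "prob A = 0"
    by (simp add: measure_le_0_iff)
  then have "AE \<omega> in M. \<omega> \<notin> A"
    using prob_eq_0[OF A] by simp
  then show ?thesis
    using AE_space by eventually_elim (auto simp: A_def state_def)
qed


section \<open>Independence of the state from the next window\<close>

text \<open>The clauses match what is known of the state: the dynamics speak of coordinates below
  \<open>n\<close> only, and the values are almost surely within \<open>bound\<close>, so
  boundedness on that box is enough for integrability even of unbounded polynomials.\<close>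

definition observable :: "((nat \<Rightarrow> real) \<Rightarrow> real) \<Rightarrow> bool" where
  "observable \<phi> \<longleftrightarrow> \<phi> \<in> borel_measurable (PiM UNIV (\<lambda>_. borel)) \<and>
     (\<forall>v w. (\<forall>i<n. v i = w i) \<longrightarrow> \<phi> v = \<phi> w) \<and>
     (\<exists>C. \<forall>v. (\<forall>i<n. \<bar>v i\<bar> \<le> bound) \<longrightarrow> \<bar>\<phi> v\<bar> \<le> C)"

lemma observable_measurable_comp:
  assumes "observable \<phi>" "\<And>i. (\<lambda>\<omega>. y \<omega> i) \<in> borel_measurable N"
  shows "(\<lambda>\<omega>. \<phi> (y \<omega>)) \<in> borel_measurable N"
proof (rule measurable_compose[of y N "PiM UNIV (\<lambda>_. borel)"])
  show "y \<in> measurable N (PiM UNIV (\<lambda>_. borel))"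
    by (rule measurable_PiM_single') (use assms(2) in auto)
qed (use assms(1) in \<open>simp add: observable_def\<close>)

lemma observable_cong: "observable \<phi> \<Longrightarrow> (\<And>i. i < n \<Longrightarrow> v i = w i) \<Longrightarrow> \<phi> v = \<phi> w"
  by (simp add: observable_def)

lemma observable_random_variable:
  assumes "observable \<phi>" "0 \<le> s"
  shows "random_variable borel (\<lambda>\<omega>. \<phi> (x s \<omega>))"
proof -
  have "(\<lambda>\<omega>. \<phi> (x s \<omega>)) = (\<lambda>\<omega>. \<phi> (state s \<omega>))"
    by (intro ext observable_cong[OF assms(1)]) (simp add: state_def)
  then show ?thesis
    using observable_measurable_comp[OF assms(1) state_measurable[OF assms(2)]] by simp
qed

lemma observable_bounded:
  assumes "observable \<phi>"
  shows "\<exists>C\<ge>0. \<forall>s\<ge>0. AE \<omega> in M. \<bar>\<phi> (x s \<omega>)\<bar> \<le> C"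
proof -
  obtain C where C: "\<And>v. (\<forall>i<n. \<bar>v i\<bar> \<le> bound) \<Longrightarrow> \<bar>\<phi> v\<bar> \<le> C"
    using assms by (auto simp: observable_def)
  have "AE \<omega> in M. \<bar>\<phi> (x s \<omega>)\<bar> \<le> C" if "0 \<le> s" for s
    using AE_bounded[OF that] by eventually_elim (rule C)
  moreover have "0 \<le> C"
    using C[of "\<lambda>_. 0"] bound_nonneg by (auto intro: order_trans[OF abs_ge_zero])
  ultimately show ?thesis by blast
qed

lemma observable_integrable:
  assumes "observable \<phi>" "0 \<le> s"
  shows "integrable M (\<lambda>\<omega>. \<phi> (x s \<omega>))"
proof -
  obtain C where C: "\<forall>s\<ge>0. AE \<omega> in M. \<bar>\<phi> (x s \<omega>)\<bar> \<le> C"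
    using observable_bounded[OF assms(1)] by blast
  show ?thesis
    by (rule integrable_const_bound[of _ C]) (use C[rule_format, OF assms(2)] observable_random_variable[OF assms] in auto)
qed

lemma observable_const [intro]: "observable (\<lambda>_. q)"
  by (auto simp: observable_def)

lemma observable_component [intro]: "i < n \<Longrightarrow> observable (\<lambda>v. v i)"
  by (auto simp: observable_def)

lemma observable_add [intro]:
  assumes "observable \<phi>" "observable \<psi>"
  shows "observable (\<lambda>v. \<phi> v + \<psi> v)"
proof -
  obtain C C' where "\<And>v. (\<forall>i<n. \<bar>v i\<bar> \<le> bound) \<Longrightarrow> \<bar>\<phi> v\<bar> \<le> C" "\<And>v. (\<forall>i<n. \<bar>v i\<bar> \<le> bound) \<Longrightarrow> \<bar>\<psi> v\<bar> \<le> C'"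
    using assms by (auto simp: observable_def)
  then have "\<forall>v. (\<forall>i<n. \<bar>v i\<bar> \<le> bound) \<longrightarrow> \<bar>\<phi> v + \<psi> v\<bar> \<le> C + C'"
    by (meson abs_triangle_ineq add_mono order_trans)
  moreover have "\<phi> v + \<psi> v = \<phi> w + \<psi> w" if "\<forall>i<n. v i = w i" for v w
    using that observable_cong[OF assms(1), of v w] observable_cong[OF assms(2), of v w] by simp
  ultimately show ?thesis
    using assms unfolding observable_def by auto
qed

lemma observable_mult [intro]:
  assumes "observable \<phi>" "observable \<psi>"
  shows "observable (\<lambda>v. \<phi> v * \<psi> v)"
proof -
  obtain C C' where C: "\<And>v. (\<forall>i<n. \<bar>v i\<bar> \<le> bound) \<Longrightarrow> \<bar>\<phi> v\<bar> \<le> C" "\<And>v. (\<forall>i<n. \<bar>v i\<bar> \<le> bound) \<Longrightarrow> \<bar>\<psi> v\<bar> \<le> C'"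
    using assms by (auto simp: observable_def)
  have "\<bar>\<phi> v * \<psi> v\<bar> \<le> C * C'" if "\<forall>i<n. \<bar>v i\<bar> \<le> bound" for v
    unfolding abs_mult using C[OF that] by (intro mult_mono) (auto intro: order_trans[OF abs_ge_zero])
  moreover have "\<phi> v * \<psi> v = \<phi> w * \<psi> w" if "\<forall>i<n. v i = w i" for v w
    using that observable_cong[OF assms(1), of v w] observable_cong[OF assms(2), of v w] by simp
  ultimately show ?thesis
    using assms unfolding observable_def by auto
qed

lemma observable_diff [intro]:
  assumes "observable \<phi>" "observable \<psi>"
  shows "observable (\<lambda>v. \<phi> v - \<psi> v)"
  using observable_add[OF assms(1) observable_mult[OF observable_const[of "- 1"] assms(2)]] by simp

lemma observable_power2 [intro]: "observable \<phi> \<Longrightarrow> observable (\<lambda>v. (\<phi> v)\<^sup>2)"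
  unfolding power2_eq_square by (rule observable_mult)

lemma observable_divide [intro]: "observable \<phi> \<Longrightarrow> observable (\<lambda>v. \<phi> v / q)"
  unfolding divide_inverse by (intro observable_mult observable_const)

lemma observable_sum [intro]:
  assumes "\<And>i. i \<in> I \<Longrightarrow> observable (\<phi> i)"
  shows "observable (\<lambda>v. \<Sum>i\<in>I. \<phi> i v)"
proof (cases "finite I")
  case True
  then show ?thesis
    using assms by (induction I) auto
qed auto

text \<open>The window is cell \<open>m\<close>, and a single activation in it uses the draws
  numbered \<open>k\<close> or \<open>l\<close>, the first that \<open>past k l m\<close> leaves
  out.\<close>

definition future :: "nat \<Rightarrow> nat \<Rightarrow> nat \<Rightarrow> (source \<times> nat) set" where
  "future k l m = {(Gossip_Clock, m), (Replacement_Clock, m), (First k, 0), (Second k, 0), (Leaving l, 0), (Arrival l, 0)}"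

lemma future_cells: "future k l m \<subseteq> cells"
  by (auto simp: future_def cells_def sources_def)

lemma past_future_disjoint: "past k l m \<inter> future k l m = {}"
  by (auto simp: past_def future_def)

text \<open>
  Measurability is asked for every \<open>m\<close> because \<open>m\<close> tends to infinity for a fixed window.
\<close>

definition future_variable :: "real \<Rightarrow> real \<Rightarrow> nat \<Rightarrow> nat \<Rightarrow> ('a \<Rightarrow> real) \<Rightarrow> bool" where
  "future_variable s h k l \<psi> \<longleftrightarrow>
     (\<forall>m>0. \<psi> \<in> borel_measurable (hist (step_grid s h m) (future k l m)))"

lemma future_variable_measurable:
  assumes "0 \<le> s" "0 \<le> h" "future_variable s h k l \<psi>"
  shows "random_variable borel \<psi>"
proof -
  have "\<psi> \<in> borel_measurable (hist (step_grid s h 1) (future k l 1))"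
    using assms(3) by (simp add: future_variable_def)
  then show ?thesis
    by (rule hist_measurable_M[rotated 2]) (intro grid_step_grid future_cells assms; simp)+
qed

abbreviation at_count :: "real \<Rightarrow> nat \<Rightarrow> nat \<Rightarrow> 'a \<Rightarrow> real" where
  "at_count s k l \<omega> \<equiv> indicat_real {k} (Ng s \<omega>) * indicat_real {l} (Nr s \<omega>)"

text \<open>A count need not be measurable for the cells, but almost surely it equals a function of
  them. The telescoping relies on paths that start at \<open>0\<close> and are monotone, since the
  differences are truncated.\<close>

lemma AE_count_eq_sum_increments:
  assumes u: "grid u"
  shows "AE \<omega> in M. Ng (u m) \<omega> = (\<Sum>j<m. increment Ng u j \<omega>) \<and> Nr (u m) \<omega> = (\<Sum>j<m. increment Nr u j \<omega>)"
  using AE_start poisson_clock_mono[OF gossip_clock] poisson_clock_mono[OF replacement_clock]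
proof eventually_elim
  case (elim \<omega>)
  have le: "Ng (u j) \<omega> \<le> Ng (u (Suc j)) \<omega>" "Nr (u j) \<omega> \<le> Nr (u (Suc j)) \<omega>" for j
    using elim(2,3) grid_nonneg[OF u] grid_Suc[OF u] by auto
  show ?case
  proof (induction m)
    case 0
    then show ?case using elim(1) u by (simp add: grid_def)
  next
    case (Suc m)
    then show ?case
      unfolding sum.lessThan_Suc using le[of m] by linarith
  qed
qed

text \<open>The target is a function of the past only where the grid is tame. \<open>W\<close>
  agrees with it there and is \<open>0\<close> elsewhere, so the error is at most \<open>C\<close>
  on the exceptional event.\<close>

lemma past_approximation:
  assumes u: "grid u" and \<phi>: "observable \<phi>" and C: "0 \<le> C" "AE \<omega> in M. \<bar>\<phi> (x (u m) \<omega>)\<bar> \<le> C"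
  obtains W where "W \<in> borel_measurable (hist u (past k l m))"
    and "AE \<omega> in M. \<bar>W \<omega>\<bar> \<le> C"
    and "AE \<omega> in M. \<bar>\<phi> (x (u m) \<omega>) * at_count (u m) k l \<omega> - W \<omega>\<bar> \<le> C * indicator {\<omega> \<in> space M. \<not> tame u m \<omega>} \<omega>"
proof -
  let ?H = "hist u (past k l m)"
  obtain y where y: "\<And>i. (\<lambda>\<omega>. y \<omega> i) \<in> borel_measurable ?H"
    and eq: "AE \<omega> in M. tame u m \<omega> \<longrightarrow> Ng (u m) \<omega> = k \<longrightarrow> Nr (u m) \<omega> = l \<longrightarrow> (\<forall>i<n. x (u m) \<omega> i = y \<omega> i)"
    using state_measurable_past[OF u, of k l m] by auto
  define U V where "U j \<omega> = real (increment Ng u j \<omega>)" and "V j \<omega> = real (increment Nr u j \<omega>)" for j \<omega>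
  have UV: "U j \<in> borel_measurable ?H" "V j \<in> borel_measurable ?H" if "j \<in> {..<m}" for j
  proof -
    have "increment Ng u j \<in> measurable ?H (count_space UNIV)" "increment Nr u j \<in> measurable ?H (count_space UNIV)"
      by (intro hist_gossip_increment hist_replacement_increment u past_cells;
          use that in \<open>simp add: past_def\<close>)+
    then show "U j \<in> borel_measurable ?H" "V j \<in> borel_measurable ?H"
      unfolding U_def V_def by (auto intro: measurable_compose)
  qed
  \<comment> \<open>The product over cells is the indicator of \<open>tame\<close>; the two other
    factors express the counts through sums of increments, which the past does measure.\<close>
  define T where "T \<omega> = (\<Prod>j<m. indicat_real {..1} (U j \<omega> + V j \<omega>)) *
    (indicat_real {real k} (\<Sum>j<m. U j \<omega>) * indicat_real {real l} (\<Sum>j<m. V j \<omega>))" for \<omega>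
  have T: "T \<in> borel_measurable ?H"
    unfolding T_def
    by (intro borel_measurable_times borel_measurable_prod
        measurable_compose[OF borel_measurable_add[OF UV] borel_measurable_indicator]
        measurable_compose[OF borel_measurable_sum[OF UV(1)] borel_measurable_indicator]
        measurable_compose[OF borel_measurable_sum[OF UV(2)] borel_measurable_indicator]) auto
  have T_untame: "T \<omega> = 0" if "\<not> tame u m \<omega>" for \<omega>
  proof -
    obtain j where "j < m" "\<not> increment Ng u j \<omega> + increment Nr u j \<omega> \<le> 1"
      using \<open>\<not> tame u m \<omega>\<close> by (auto simp: tame_def)
    then have "indicat_real {..1} (U j \<omega> + V j \<omega>) = 0"
      unfolding U_def V_def of_nat_add[symmetric] by (simp add: indicator_def)
    with \<open>j < m\<close> show ?thesis
      unfolding T_def by (auto simp: prod_zero_iff)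
  qed
  have T_tame: "AE \<omega> in M. tame u m \<omega> \<longrightarrow> T \<omega> = at_count (u m) k l \<omega>"
    using AE_count_eq_sum_increments[OF u, of m]
  proof eventually_elim
    case (elim \<omega>)
    show ?case
    proof
      assume "tame u m \<omega>"
      then have "U j \<omega> + V j \<omega> \<le> 1" if "j < m" for j
        unfolding U_def V_def of_nat_add[symmetric] tame_def using that by (metis of_nat_1 of_nat_le_iff)
      then have "(\<Prod>j<m. indicat_real {..1} (U j \<omega> + V j \<omega>)) = 1"
        by (intro prod.neutral) simp
      moreover have "(\<Sum>j<m. U j \<omega>) = real (Ng (u m) \<omega>)" "(\<Sum>j<m. V j \<omega>) = real (Nr (u m) \<omega>)"
        using elim by (simp_all add: U_def V_def)
      ultimately show "T \<omega> = at_count (u m) k l \<omega>"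
        unfolding T_def by (simp add: indicator_def)
    qed
  qed
  define W where "W \<omega> = \<phi> (y \<omega>) * T \<omega>" for \<omega>
  have W: "AE \<omega> in M. W \<omega> = (if tame u m \<omega> then \<phi> (x (u m) \<omega>) * at_count (u m) k l \<omega> else 0)"
    using eq T_tame
  proof eventually_elim
    case (elim \<omega>)
    show ?case
    proof (cases "tame u m \<omega> \<and> Ng (u m) \<omega> = k \<and> Nr (u m) \<omega> = l")
      case True
      with elim have "\<phi> (x (u m) \<omega>) = \<phi> (y \<omega>)"
        by (intro observable_cong[OF \<phi>]) auto
      with True elim show ?thesis by (simp add: W_def)
    next
      case False
      with elim T_untame show ?thesis by (auto simp: W_def)
    qed
  qed
  show thesis
  proof (rule that)
    show "W \<in> borel_measurable ?H"
      unfolding W_def by (intro borel_measurable_times T observable_measurable_comp[OF \<phi>] y)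
    show "AE \<omega> in M. \<bar>W \<omega>\<bar> \<le> C"
      using W C(2) by eventually_elim (use C(1) in \<open>auto simp: indicator_def\<close>)
    show "AE \<omega> in M. \<bar>\<phi> (x (u m) \<omega>) * at_count (u m) k l \<omega> - W \<omega>\<bar> \<le> C * indicator {\<omega> \<in> space M. \<not> tame u m \<omega>} \<omega>"
      using W C(2) AE_space by eventually_elim (use C(1) in \<open>auto simp: indicator_def\<close>)
  qed
qed

text \<open>For \<open>W\<close> in place of the state the factorization is exact, by disjointness
  of past and future. Both sides move by a multiple of the probability that the grid is not tame,
  and this vanishes under refinement.\<close>

lemma past_future_expectation_mult:
  assumes s: "0 \<le> s" and h: "0 \<le> h" and \<phi>: "observable \<phi>" and \<psi>: "future_variable s h k l \<psi>"
    and \<psi>_bound: "AE \<omega> in M. \<bar>\<psi> \<omega>\<bar> \<le> C'"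
  shows "expectation (\<lambda>\<omega>. (\<phi> (x s \<omega>) * at_count s k l \<omega>) * \<psi> \<omega>) =
    expectation (\<lambda>\<omega>. \<phi> (x s \<omega>) * at_count s k l \<omega>) * expectation \<psi>"
proof -
  obtain C where C0: "0 \<le> C" and C1: "\<forall>s\<ge>0. AE \<omega> in M. \<bar>\<phi> (x s \<omega>)\<bar> \<le> C"
    using observable_bounded[OF \<phi>] by blast
  note C = C0 C1[rule_format, OF s]
  let ?F = "\<lambda>\<omega>. \<phi> (x s \<omega>) * at_count s k l \<omega>"
  have \<psi>_meas: "random_variable borel \<psi>"
    by (rule future_variable_measurable[OF s h \<psi>])
  have \<psi>_int: "integrable M \<psi>"
    by (rule integrable_const_bound[of _ C']) (use \<psi>_meas \<psi>_bound in auto)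
  have F_meas: "random_variable borel ?F"
    by (intro borel_measurable_times observable_random_variable[OF \<phi> s]
        measurable_compose[OF Ng_measurable[OF s]] measurable_compose[OF Nr_measurable[OF s]]) auto
  have F_bound: "AE \<omega> in M. \<bar>?F \<omega>\<bar> \<le> C"
    using C(2) by eventually_elim (use C(1) in \<open>auto simp: indicator_def\<close>)
  have F_int: "integrable M ?F"
    by (rule integrable_const_bound[of _ C]) (use F_meas F_bound in auto)
  have C': "0 \<le> C'"
  proof -
    have "AE \<omega> in M. 0 \<le> C'"
      using \<psi>_bound by eventually_elim simp
    then show ?thesis by simp
  qed
  have prod_int: "integrable M (\<lambda>\<omega>. G \<omega> * \<psi> \<omega>)"
    if "random_variable borel G" "AE \<omega> in M. \<bar>G \<omega>\<bar> \<le> C" for G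
  proof (rule integrable_const_bound[of _ "C * C'"])
    show "AE \<omega> in M. norm (G \<omega> * \<psi> \<omega>) \<le> C * C'"
      using that(2) \<psi>_bound by eventually_elim (auto simp: abs_mult intro!: mult_mono C)
  qed (use that(1) \<psi>_meas in simp)
  \<comment> \<open>The defect \<open>r\<close> does not depend on \<open>m\<close>. In the bound
    below, \<open>C * C'\<close> pays for inserting \<open>W\<close> into the expectation of the
    product and \<open>C * \<bar>expectation \<psi>\<bar>\<close> for inserting it into the product
    of expectations.\<close>
  define r where "r = \<bar>expectation (\<lambda>\<omega>. ?F \<omega> * \<psi> \<omega>) - expectation ?F * expectation \<psi>\<bar>"
  have "r \<le> (C * C' + C * \<bar>expectation \<psi>\<bar>) * (rate * s)\<^sup>2 / real m" if m: "0 < m" for m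
  proof -
    let ?u = "step_grid s h m"
    note u = grid_step_grid[OF s h m]
    let ?A = "{\<omega> \<in> space M. \<not> tame ?u m \<omega>}"
    have um: "?u m = s" using m by simp
    obtain W where W: "W \<in> borel_measurable (hist ?u (past k l m))"
      and W_bound: "AE \<omega> in M. \<bar>W \<omega>\<bar> \<le> C"
      and W_diff: "AE \<omega> in M. \<bar>?F \<omega> - W \<omega>\<bar> \<le> C * indicator ?A \<omega>"
      by (rule past_approximation[OF u \<phi>, of C m k l, unfolded um, OF C])
    have W_meas: "random_variable borel W"
      by (rule hist_measurable_M[OF u past_cells W])
    have W_int: "integrable M W"
      by (rule integrable_const_bound[of _ C]) (use W_meas W_bound in auto)
    have indep: "expectation (\<lambda>\<omega>. W \<omega> * \<psi> \<omega>) = expectation W * expectation \<psi>"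
      using \<psi> m by (intro hist_expectation_mult(2)[OF u past_cells future_cells past_future_disjoint W W_int _ \<psi>_int])
        (simp add: future_variable_def)
    have "\<bar>expectation (\<lambda>\<omega>. ?F \<omega> * \<psi> \<omega>) - expectation (\<lambda>\<omega>. W \<omega> * \<psi> \<omega>)\<bar> \<le> (C * C') * prob ?A"
    proof (rule expectation_diff_le[OF prod_int[OF F_meas F_bound] prod_int[OF W_meas W_bound] tame_measurable[OF u]])
      show "AE \<omega> in M. \<bar>?F \<omega> * \<psi> \<omega> - W \<omega> * \<psi> \<omega>\<bar> \<le> C * C' * indicator ?A \<omega>"
        using W_diff \<psi>_bound
      proof eventually_elim
        case (elim \<omega>)
        have "\<bar>?F \<omega> * \<psi> \<omega> - W \<omega> * \<psi> \<omega>\<bar> = \<bar>?F \<omega> - W \<omega>\<bar> * \<bar>\<psi> \<omega>\<bar>"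
          by (simp only: abs_mult[symmetric] left_diff_distrib)
        also have "\<dots> \<le> (C * indicator ?A \<omega>) * C'"
          using elim C(1) by (intro mult_mono) auto
        finally show ?case by (simp add: ac_simps)
      qed
    qed
    moreover have "\<bar>expectation ?F - expectation W\<bar> \<le> C * prob ?A"
      by (rule expectation_diff_le[OF F_int W_int tame_measurable[OF u] W_diff])
    then have "\<bar>expectation ?F - expectation W\<bar> * \<bar>expectation \<psi>\<bar> \<le> C * prob ?A * \<bar>expectation \<psi>\<bar>"
      by (rule mult_right_mono) simp
    then have "\<bar>expectation W * expectation \<psi> - expectation ?F * expectation \<psi>\<bar> \<le> C * prob ?A * \<bar>expectation \<psi>\<bar>"
      by (simp only: abs_mult[symmetric] left_diff_distrib abs_minus_commute)
    ultimately have "r \<le> (C * C') * prob ?A + C * prob ?A * \<bar>expectation \<psi>\<bar>"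
      unfolding r_def indep by linarith
    also have "\<dots> = (C * C' + C * \<bar>expectation \<psi>\<bar>) * prob ?A"
      by (simp add: algebra_simps)
    also have "\<dots> \<le> (C * C' + C * \<bar>expectation \<psi>\<bar>) * ((rate * s)\<^sup>2 / real m)"
      using C(1) C' by (intro mult_left_mono prob_not_tame s h m) auto
    finally show ?thesis by simp
  qed
  then have "r \<le> 0"
    by (rule nonpos_of_le_inverse_nat)
  then show ?thesis
    by (simp add: r_def)
qed

text \<open>A Markov property in integrated form: evaluating \<open>\<psi>\<close> at the random
  counts selects the draws that the window really uses, and the common value \<open>e\<close> comes
  out of the sum over all counts.\<close>

lemma expectation_mult_future:
  assumes s: "0 \<le> s" and h: "0 \<le> h" and \<phi>: "observable \<phi>"
    and \<psi>: "\<And>k l. future_variable s h k l (\<psi> k l)"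
    and \<psi>_bound: "\<And>k l. AE \<omega> in M. \<bar>\<psi> k l \<omega>\<bar> \<le> C'"
    and e: "\<And>k l. expectation (\<psi> k l) = e"
  shows "integrable M (\<lambda>\<omega>. \<phi> (x s \<omega>) * \<psi> (Ng s \<omega>) (Nr s \<omega>) \<omega>)"
    and "expectation (\<lambda>\<omega>. \<phi> (x s \<omega>) * \<psi> (Ng s \<omega>) (Nr s \<omega>) \<omega>) = e * expectation (\<lambda>\<omega>. \<phi> (x s \<omega>))"
proof -
  let ?\<Psi> = "\<lambda>\<omega>. \<psi> (Ng s \<omega>) (Nr s \<omega>) \<omega>"
  obtain C where C0: "0 \<le> C" and C1: "\<forall>s\<ge>0. AE \<omega> in M. \<bar>\<phi> (x s \<omega>)\<bar> \<le> C"
    using observable_bounded[OF \<phi>] by blast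
  note C = C0 C1[rule_format, OF s]
  have \<psi>_meas: "random_variable borel (\<psi> k l)" for k l
    by (rule future_variable_measurable[OF s h \<psi>])
  have \<Psi>_meas: "random_variable borel ?\<Psi>"
    by (rule measurable_compose_countable[OF measurable_compose_countable[OF \<psi>_meas Nr_measurable[OF s]] Ng_measurable[OF s]])
  have \<Psi>_bound: "AE \<omega> in M. \<bar>?\<Psi> \<omega>\<bar> \<le> C'"
  proof -
    have "AE \<omega> in M. \<forall>k l. \<bar>\<psi> k l \<omega>\<bar> \<le> C'"
      using \<psi>_bound by (simp add: AE_all_countable)
    then show ?thesis by eventually_elim simp
  qed
  show int: "integrable M (\<lambda>\<omega>. \<phi> (x s \<omega>) * ?\<Psi> \<omega>)"
  proof (rule integrable_const_bound[of _ "C * C'"])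
    show "AE \<omega> in M. norm (\<phi> (x s \<omega>) * ?\<Psi> \<omega>) \<le> C * C'"
      using C(2) \<Psi>_bound by eventually_elim (auto simp: abs_mult intro!: mult_mono C(1))
  qed (intro borel_measurable_times observable_random_variable[OF \<phi> s] \<Psi>_meas)
  \<comment> \<open>The pair of counts is packed into one natural number so that
    \<open>expectation_eq_by_value\<close> can split by it.\<close>
  define X where "X \<omega> = prod_encode (Ng s \<omega>, Nr s \<omega>)" for \<omega>
  have "expectation (\<lambda>\<omega>. \<phi> (x s \<omega>) * ?\<Psi> \<omega>) = expectation (\<lambda>\<omega>. e * \<phi> (x s \<omega>))"
  proof (rule expectation_eq_by_value[OF int])
    show "integrable M (\<lambda>\<omega>. e * \<phi> (x s \<omega>))"
      by (intro integrable_mult_right observable_integrable[OF \<phi> s])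
    show "random_variable (count_space UNIV) X"
      unfolding X_def by (rule measurable_count_space_binary[OF Ng_measurable[OF s] Nr_measurable[OF s]])
    fix p
    obtain k l where p: "p = prod_encode (k, l)"
      by (metis prod_decode_inverse surj_pair)
    have X: "indicat_real {p} (X \<omega>) = at_count s k l \<omega>" for \<omega>
      by (auto simp: p X_def indicator_def)
    have "expectation (\<lambda>\<omega>. (\<phi> (x s \<omega>) * ?\<Psi> \<omega>) * indicator {p} (X \<omega>)) =
        expectation (\<lambda>\<omega>. (\<phi> (x s \<omega>) * at_count s k l \<omega>) * \<psi> k l \<omega>)"
      unfolding X by (intro Bochner_Integration.integral_cong) (auto simp: indicator_def)
    also have "\<dots> = expectation (\<lambda>\<omega>. \<phi> (x s \<omega>) * at_count s k l \<omega>) * e"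
      using past_future_expectation_mult[OF s h \<phi> \<psi> \<psi>_bound] e by simp
    also have "\<dots> = expectation (\<lambda>\<omega>. (e * \<phi> (x s \<omega>)) * indicator {p} (X \<omega>))"
      unfolding X by (simp add: mult.assoc mult.commute[of _ e])
    finally show "expectation (\<lambda>\<omega>. (\<phi> (x s \<omega>) * ?\<Psi> \<omega>) * indicator {p} (X \<omega>)) =
      expectation (\<lambda>\<omega>. (e * \<phi> (x s \<omega>)) * indicator {p} (X \<omega>))" .
  qed
  then show "expectation (\<lambda>\<omega>. \<phi> (x s \<omega>) * ?\<Psi> \<omega>) = e * expectation (\<lambda>\<omega>. \<phi> (x s \<omega>))"
    by simp
qed


section \<open>The events of a short window\<close>

lemma observable_expectation_bounded:
  assumes "observable \<phi>"
  shows "\<exists>C\<ge>0. \<forall>s\<ge>0. \<bar>expectation (\<lambda>\<omega>. \<phi> (x s \<omega>))\<bar> \<le> C"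
proof -
  obtain C where C: "0 \<le> C" "\<forall>s\<ge>0. AE \<omega> in M. \<bar>\<phi> (x s \<omega>)\<bar> \<le> C"
    using observable_bounded[OF assms] by blast
  have "\<bar>expectation (\<lambda>\<omega>. \<phi> (x s \<omega>))\<bar> \<le> C" if s: "0 \<le> s" for s
  proof -
    have "\<bar>expectation (\<lambda>\<omega>. \<phi> (x s \<omega>))\<bar> \<le> expectation (\<lambda>\<omega>. \<bar>\<phi> (x s \<omega>)\<bar>)"
      by (rule integral_abs_bound)
    also have "\<dots> \<le> expectation (\<lambda>\<omega>. C)"
      using C(2) s observable_integrable[OF assms s] by (intro integral_mono_AE) auto
    finally show ?thesis by (simp add: prob_space)
  qed
  with C(1) show ?thesis by blast
qed

lemma expectation_uniform_indicator:
  assumes "random_variable (count_space UNIV) f"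
    and "distr M (count_space UNIV) f = measure_pmf (pmf_of_set {..<n})" and "i < n"
  shows "expectation (\<lambda>\<omega>. indicat_real {i} (f \<omega>)) = 1 / real n"
proof -
  have "expectation (\<lambda>\<omega>. indicat_real {i} (f \<omega>)) = measure (distr M (count_space UNIV) f) {i}"
    using expectation_indicator_comp[OF assms(1), of "{i}"] assms(1) by (simp add: measure_distr)
  also have "\<dots> = 1 / real n"
    unfolding assms(2) using assms(3) by (simp add: measure_pmf_single pmf_of_set lessThan_empty_iff)
  finally show ?thesis .
qed

lemma expectation_arrival_moments:
  shows "expectation (\<lambda>\<omega>. z k \<omega>) = 0" "expectation (\<lambda>\<omega>. (z k \<omega>)\<^sup>2) = \<sigma>\<^sup>2"
proof -
  have "expectation (\<lambda>\<omega>. z k \<omega>) = integral\<^sup>L D (\<lambda>y. y)"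
    unfolding z_distributed[of k, symmetric] by (simp add: integral_distr z_measurable)
  then show "expectation (\<lambda>\<omega>. z k \<omega>) = 0"
    using D_mean by simp
  have "expectation (\<lambda>\<omega>. (z k \<omega>)\<^sup>2) = integral\<^sup>L D (\<lambda>y. y\<^sup>2)"
    unfolding z_distributed[of k, symmetric] by (simp add: integral_distr z_measurable)
  then show "expectation (\<lambda>\<omega>. (z k \<omega>)\<^sup>2) = \<sigma>\<^sup>2"
    using D_variance D_mean by simp
qed

text \<open>The draw number \<open>k\<close> is a free parameter here, so that independence applies;
  it is later evaluated at \<open>Ng s \<omega>\<close>.\<close>

definition gossip_event :: "real \<Rightarrow> real \<Rightarrow> nat \<Rightarrow> nat \<Rightarrow> nat \<Rightarrow> 'a \<Rightarrow> real" where
  "gossip_event s h i j k \<omega> = indicator {1} (Ng (s + h) \<omega> - Ng s \<omega>) * indicator {0} (Nr (s + h) \<omega> - Nr s \<omega>) *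
     indicator {i} (a k \<omega>) * indicator {j} (b k \<omega>)"

definition replacement_event :: "real \<Rightarrow> real \<Rightarrow> nat \<Rightarrow> nat \<Rightarrow> 'a \<Rightarrow> real" where
  "replacement_event s h i l \<omega> = indicator {0} (Ng (s + h) \<omega> - Ng s \<omega>) * indicator {1} (Nr (s + h) \<omega> - Nr s \<omega>) *
     indicator {i} (c l \<omega>)"

lemma measurable_clock_indicators:
  assumes "0 \<le> s" "0 \<le> h" "0 < m" "J \<subseteq> cells" "(Gossip_Clock, m) \<in> J" "(Replacement_Clock, m) \<in> J"
  shows "(\<lambda>\<omega>. indicat_real {p} (Ng (s + h) \<omega> - Ng s \<omega>) * indicator {q} (Nr (s + h) \<omega> - Nr s \<omega>))
    \<in> borel_measurable (hist (step_grid s h m) J)"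
proof -
  note u = grid_step_grid[OF assms(1-3)]
  have "(\<lambda>\<omega>. indicat_real {p} (increment Ng (step_grid s h m) m \<omega>) * indicator {q} (increment Nr (step_grid s h m) m \<omega>))
    \<in> borel_measurable (hist (step_grid s h m) J)"
    by (intro borel_measurable_times measurable_compose[OF hist_gossip_increment[OF u assms(4,5)]]
        measurable_compose[OF hist_replacement_increment[OF u assms(4,6)]]) auto
  then show ?thesis using assms(3) by simp
qed

lemma future_gossip_event:
  assumes "0 \<le> s" "0 \<le> h"
  shows "future_variable s h k l (gossip_event s h i j k)"
  unfolding future_variable_def
proof (intro allI impI)
  fix m :: nat assume m: "0 < m"
  note u = grid_step_grid[OF assms m]
  have "a k \<in> measurable (hist (step_grid s h m) (future k l m)) (count_space UNIV)"
    "b k \<in> measurable (hist (step_grid s h m) (future k l m)) (count_space UNIV)"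
    by (intro hist_First hist_Second u future_cells; simp add: future_def)+
  then show "gossip_event s h i j k \<in> borel_measurable (hist (step_grid s h m) (future k l m))"
    unfolding gossip_event_def
    by (intro borel_measurable_times[OF borel_measurable_times[OF measurable_clock_indicators[OF assms m]]])
      (auto intro: measurable_compose[of _ _ "count_space UNIV"] future_cells[THEN subsetD] simp: future_def)
qed

text \<open>The effect of a replacement on a descriptor is quadratic in the arriving value, so the
  powers \<open>q = 0, 1, 2\<close> are what is needed.\<close>

lemma future_replacement_event:
  assumes "0 \<le> s" "0 \<le> h"
  shows "future_variable s h k l (\<lambda>\<omega>. replacement_event s h i l \<omega> * (z l \<omega>) ^ q)"
  unfolding future_variable_def
proof (intro allI impI)
  fix m :: nat assume m: "0 < m"
  note u = grid_step_grid[OF assms m]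
  have "c l \<in> measurable (hist (step_grid s h m) (future k l m)) (count_space UNIV)"
    "z l \<in> borel_measurable (hist (step_grid s h m) (future k l m))"
    by (intro hist_Leaving hist_Arrival u future_cells; simp add: future_def)+
  then show "(\<lambda>\<omega>. replacement_event s h i l \<omega> * (z l \<omega>) ^ q) \<in> borel_measurable (hist (step_grid s h m) (future k l m))"
    unfolding replacement_event_def
    by (intro borel_measurable_times[OF borel_measurable_times[OF measurable_clock_indicators[OF assms m]]])
      (auto intro: measurable_compose[of _ _ "count_space UNIV"] future_cells[THEN subsetD] simp: future_def)
qed

definition p_gossip :: "real \<Rightarrow> real" where
  "p_gossip h = poisson_mass (real n * lam_g * h) 1 * poisson_mass (real n * lam_r * h) 0"

definition p_replacement :: "real \<Rightarrow> real" where
  "p_replacement h = poisson_mass (real n * lam_g * h) 0 * poisson_mass (real n * lam_r * h) 1"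

text \<open>\<open>1 - exp (- r)\<close> lies between \<open>0\<close> and \<open>r\<close>. With
  \<open>r = rate * h\<close> this compares the probability of exactly one activation, on a
  prescribed clock, with its first-order term.\<close>

lemma abs_linear_exp_diff:
  fixes y r :: real
  assumes "0 \<le> y" "0 \<le> r"
  shows "\<bar>y * exp (- r) - y\<bar> \<le> y * r"
proof -
  have "y * (1 - exp (- r)) \<le> y * r"
    using exp_ge_add_one_self[of "- r"] assms by (intro mult_left_mono) auto
  moreover have "0 \<le> y * (1 - exp (- r))"
    using assms by auto
  ultimately show ?thesis
    by (simp add: algebra_simps abs_if)
qed

lemma p_gossip_approx:
  assumes "0 \<le> h"
  shows "\<bar>p_gossip h - real n * lam_g * h\<bar> \<le> real n * lam_g * rate * h\<^sup>2"
proof -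
  have "p_gossip h = (real n * lam_g * h) * exp (- (rate * h))"
    by (simp add: p_gossip_def poisson_mass_def rate_def exp_add[symmetric] algebra_simps)
  then show ?thesis
    using abs_linear_exp_diff[of "real n * lam_g * h" "rate * h"] assms lam_g_nonneg rate_nonneg
    by (simp add: power2_eq_square algebra_simps)
qed

lemma p_replacement_approx:
  assumes "0 \<le> h"
  shows "\<bar>p_replacement h - real n * lam_r * h\<bar> \<le> real n * lam_r * rate * h\<^sup>2"
proof -
  have "p_replacement h = (real n * lam_r * h) * exp (- (rate * h))"
    by (simp add: p_replacement_def poisson_mass_def rate_def exp_add[symmetric] algebra_simps)
  then show ?thesis
    using abs_linear_exp_diff[of "real n * lam_r * h" "rate * h"] assms lam_r_nonneg rate_nonneg
    by (simp add: power2_eq_square algebra_simps)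
qed

lemma expectation_gossip_event:
  assumes "0 \<le> s" "0 \<le> h" "i < n" "j < n"
  shows "expectation (gossip_event s h i j k) = p_gossip h / (real n)\<^sup>2"
proof -
  \<comment> \<open>With \<open>m = 1\<close> the grid is \<open>0, s, s + h\<close>, so cell
    \<open>1\<close> is the window. The clocks are separated from the first draw, and both of these
    from the second.\<close>
  let ?u = "step_grid s h 1"
  note u = grid_step_grid[OF assms(1,2) zero_less_one]
  let ?X = "\<lambda>\<omega>. indicat_real {1} (Ng (s + h) \<omega> - Ng s \<omega>) * indicator {0} (Nr (s + h) \<omega> - Nr s \<omega>)"
  let ?A = "\<lambda>\<omega>. indicat_real {i} (a k \<omega>)" and ?B = "\<lambda>\<omega>. indicat_real {j} (b k \<omega>)"
  let ?J = "{(Gossip_Clock, 1), (Replacement_Clock, 1)}"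
  have sub: "insert (First k, 0) ?J \<subseteq> cells" "{(First k, 0)} \<subseteq> cells" "{(Second k, 0)} \<subseteq> cells" "?J \<subseteq> cells"
    by (auto simp: cells_def sources_def)
  have X: "?X \<in> borel_measurable (hist ?u J)" if "?J \<subseteq> J" "J \<subseteq> cells" for J
    using measurable_clock_indicators[OF assms(1,2) zero_less_one that(2)] that(1) by simp
  have A: "?A \<in> borel_measurable (hist ?u J)" if "(First k, 0) \<in> J" "J \<subseteq> cells" for J
    by (rule measurable_compose[OF hist_First[OF u that(2,1)]]) simp
  have B: "?B \<in> borel_measurable (hist ?u {(Second k, 0)})"
    by (rule measurable_compose[OF hist_Second[OF u sub(3)]]) simp_all
  have X_int: "integrable M ?X"
    by (rule integrable_const_bound[of _ 1])
      (use hist_measurable_M[OF u sub(4) X[OF order.refl sub(4)]] in \<open>auto simp: indicator_def\<close>)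
  have A_int: "integrable M ?A"
    by (rule integrable_indicator_comp[OF a_measurable]) simp
  have B_int: "integrable M ?B"
    by (rule integrable_indicator_comp[OF b_measurable]) simp
  have XA: "integrable M (\<lambda>\<omega>. ?X \<omega> * ?A \<omega>)"
    "expectation (\<lambda>\<omega>. ?X \<omega> * ?A \<omega>) = expectation ?X * expectation ?A"
    by (rule hist_expectation_mult[OF u sub(4,2) _ X[OF order.refl sub(4)] X_int A[OF _ sub(2)] A_int]; simp)+
  have "expectation (gossip_event s h i j k) = expectation (\<lambda>\<omega>. (?X \<omega> * ?A \<omega>) * ?B \<omega>)"
    by (simp add: gossip_event_def[abs_def])
  also have "\<dots> = expectation (\<lambda>\<omega>. ?X \<omega> * ?A \<omega>) * expectation ?B"
    by (rule hist_expectation_mult(2)[OF u sub(1,3) _ borel_measurable_times[OF X[OF _ sub(1)] A[OF _ sub(1)]] XA(1) B B_int]) auto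
  finally show ?thesis
    unfolding XA(2) expectation_uniform_indicator[OF a_measurable a_uniform assms(3)]
      expectation_uniform_indicator[OF b_measurable b_uniform assms(4)]
    using expectation_increments[OF u, of 1 1 0] by (simp add: p_gossip_def power2_eq_square)
qed

lemma z_power_integrable: "integrable M (\<lambda>\<omega>. (z l \<omega>) ^ q)"
proof (rule integrable_const_bound[of _ "bound ^ q"])
  show "AE \<omega> in M. norm ((z l \<omega>) ^ q) \<le> bound ^ q"
    using AE_arrivals_bound by eventually_elim (simp add: power_abs power_mono)
qed (use z_measurable in simp)

lemma expectation_replacement_event:
  assumes "0 \<le> s" "0 \<le> h" "i < n"
  shows "expectation (\<lambda>\<omega>. replacement_event s h i l \<omega> * (z l \<omega>) ^ q) =
    p_replacement h / real n * expectation (\<lambda>\<omega>. (z l \<omega>) ^ q)"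
proof -
  let ?u = "step_grid s h 1"
  note u = grid_step_grid[OF assms(1,2) zero_less_one]
  let ?X = "\<lambda>\<omega>. indicat_real {0} (Ng (s + h) \<omega> - Ng s \<omega>) * indicator {1} (Nr (s + h) \<omega> - Nr s \<omega>)"
  let ?A = "\<lambda>\<omega>. indicat_real {i} (c l \<omega>)" and ?B = "\<lambda>\<omega>. (z l \<omega>) ^ q"
  let ?J = "{(Gossip_Clock, 1), (Replacement_Clock, 1)}"
  have sub: "insert (Leaving l, 0) ?J \<subseteq> cells" "{(Leaving l, 0)} \<subseteq> cells" "{(Arrival l, 0)} \<subseteq> cells" "?J \<subseteq> cells"
    by (auto simp: cells_def sources_def)
  have X: "?X \<in> borel_measurable (hist ?u J)" if "?J \<subseteq> J" "J \<subseteq> cells" for J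
    using measurable_clock_indicators[OF assms(1,2) zero_less_one that(2)] that(1) by simp
  have A: "?A \<in> borel_measurable (hist ?u J)" if "(Leaving l, 0) \<in> J" "J \<subseteq> cells" for J
    by (rule measurable_compose[OF hist_Leaving[OF u that(2,1)]]) simp
  have B: "?B \<in> borel_measurable (hist ?u {(Arrival l, 0)})"
    by (rule borel_measurable_power[OF hist_Arrival[OF u sub(3)]]) simp
  have X_int: "integrable M ?X"
    by (rule integrable_const_bound[of _ 1])
      (use hist_measurable_M[OF u sub(4) X[OF order.refl sub(4)]] in \<open>auto simp: indicator_def\<close>)
  have A_int: "integrable M ?A"
    by (rule integrable_indicator_comp[OF c_measurable]) simp
  have XA: "integrable M (\<lambda>\<omega>. ?X \<omega> * ?A \<omega>)"
    "expectation (\<lambda>\<omega>. ?X \<omega> * ?A \<omega>) = expectation ?X * expectation ?A"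
    by (rule hist_expectation_mult[OF u sub(4,2) _ X[OF order.refl sub(4)] X_int A[OF _ sub(2)] A_int]; simp)+
  have "expectation (\<lambda>\<omega>. replacement_event s h i l \<omega> * (z l \<omega>) ^ q) = expectation (\<lambda>\<omega>. (?X \<omega> * ?A \<omega>) * ?B \<omega>)"
    by (simp add: replacement_event_def[abs_def])
  also have "\<dots> = expectation (\<lambda>\<omega>. ?X \<omega> * ?A \<omega>) * expectation ?B"
    by (rule hist_expectation_mult(2)[OF u sub(1,3) _ borel_measurable_times[OF X[OF _ sub(1)] A[OF _ sub(1)]] XA(1) B z_power_integrable]) auto
  finally show ?thesis
    unfolding XA(2) expectation_uniform_indicator[OF c_measurable c_uniform assms(3)]
    using expectation_increments[OF u, of 0 1 1] by (simp add: p_replacement_def)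
qed

end

section \<open>Effect of the interactions on the descriptors\<close>

lemma sum_fun_upd:
  fixes g :: "'b \<Rightarrow> real"
  assumes "finite A" "i \<in> A"
  shows "(\<Sum>m\<in>A. g ((v(i := y)) m)) = (\<Sum>m\<in>A. g (v m)) - g (v i) + g y"
proof -
  have "(\<Sum>m\<in>A - {i}. g ((v(i := y)) m)) = (\<Sum>m\<in>A - {i}. g (v m))"
    by (rule sum.cong) auto
  then show ?thesis
    using sum.remove[OF assms, of "\<lambda>m. g (v m)"] sum.remove[OF assms, of "\<lambda>m. g ((v(i := y)) m)"] by simp
qed

lemma sum_gossip:
  fixes g :: "real \<Rightarrow> real"
  assumes "i < n" "j < n"
  shows "(\<Sum>m<n. g (gossip i j v m)) = (\<Sum>m<n. g (v m)) - g (v i) - g (v j) + 2 * g ((v i + v j) / 2)"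
proof -
  define w where "w = (v i + v j) / 2"
  have "(\<Sum>m<n. g (gossip i j v m)) = (\<Sum>m<n. g ((v(i := w)) m)) - g ((v(i := w)) j) + g w"
    unfolding gossip_def w_def[symmetric] using assms by (intro sum_fun_upd) auto
  also have "(\<Sum>m<n. g ((v(i := w)) m)) = (\<Sum>m<n. g (v m)) - g (v i) + g w"
    using assms by (intro sum_fun_upd) auto
  finally have "(\<Sum>m<n. g (gossip i j v m)) = (\<Sum>m<n. g (v m)) - g (v i) + g w - g ((v(i := w)) j) + g w" .
  \<comment> \<open>This also holds for \<open>i = j\<close>: then \<open>w = v i\<close>, and the
    first update changes nothing.\<close>
  moreover have "g ((v(i := w)) j) = g (v j)"
    by (simp add: w_def)
  ultimately show ?thesis
    by (simp add: w_def)
qed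

lemma squared_mean_gossip:
  assumes "i < n" "j < n"
  shows "squared_mean n (gossip i j v) = squared_mean n v"
proof -
  have "(\<Sum>m<n. gossip i j v m) = (\<Sum>m<n. v m)"
    using sum_gossip[OF assms, of "\<lambda>y. y" v] by (simp add: field_simps)
  then show ?thesis by (simp add: squared_mean_def)
qed

text \<open>Replacing \<open>p\<close> and \<open>q\<close> by their average lowers the sum of
  squares by \<open>(p - q)\<^sup>2 / 2\<close>. The change is written as an added term to fit
  \<open>expectation_increment_estimate\<close>.\<close>

lemma mean_of_squares_gossip:
  assumes "i < n" "j < n"
  shows "mean_of_squares n (gossip i j v) = mean_of_squares n v + - (v i - v j)\<^sup>2 / (2 * real n)"
  unfolding mean_of_squares_def sum_gossip[OF assms, of "\<lambda>y. y\<^sup>2" v]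
  using assms by (simp add: field_simps power2_eq_square)

text \<open>The change is arranged as a polynomial in the arriving value \<open>y\<close>: its
  coefficients depend on the present state alone, so state and arrival can be averaged
  separately.\<close>

lemma squared_mean_replacement:
  assumes "i < n"
  shows "squared_mean n (replacement i y v) = squared_mean n v +
    ((((\<Sum>m<n. v m) - v i)\<^sup>2 - (\<Sum>m<n. v m)\<^sup>2) / (real n)\<^sup>2 + 2 * ((\<Sum>m<n. v m) - v i) / (real n)\<^sup>2 * y +
      1 / (real n)\<^sup>2 * y\<^sup>2)"
proof -
  have "(\<Sum>m<n. replacement i y v m) = (\<Sum>m<n. v m) - v i + y"
    unfolding replacement_def using assms sum_fun_upd[of "{..<n}" i "\<lambda>y. y" v y] by simp
  then show ?thesis
    using assms by (simp add: squared_mean_def power_divide) (simp add: field_simps power2_eq_square)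
qed

lemma mean_of_squares_replacement:
  assumes "i < n"
  shows "mean_of_squares n (replacement i y v) = mean_of_squares n v +
    (- (v i)\<^sup>2 / real n + 0 * y + 1 / real n * y\<^sup>2)"
  unfolding mean_of_squares_def replacement_def
  using assms sum_fun_upd[of "{..<n}" i "\<lambda>y. y\<^sup>2" v y] by (simp add: field_simps)

lemma sum_pairwise_square_diff:
  fixes v :: "nat \<Rightarrow> real"
  shows "(\<Sum>i<n. \<Sum>j<n. (v i - v j)\<^sup>2) = 2 * real n * (\<Sum>i<n. (v i)\<^sup>2) - 2 * (\<Sum>i<n. v i)\<^sup>2"
proof -
  have "(\<Sum>i<n. \<Sum>j<n. (v i - v j)\<^sup>2) = (\<Sum>i<n. \<Sum>j<n. (v i)\<^sup>2 + (v j)\<^sup>2 - 2 * (v i * v j))"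
    by (intro sum.cong refl) (simp add: power2_diff)
  also have "\<dots> = 2 * real n * (\<Sum>i<n. (v i)\<^sup>2) - 2 * ((\<Sum>i<n. v i) * (\<Sum>j<n. v j))"
    by (simp add: sum.distrib sum_subtractf sum_distrib_left[symmetric] sum_product)
  finally show ?thesis by (simp add: power2_eq_square)
qed

lemma sum_mult_indicator_singleton:
  fixes g :: "nat \<Rightarrow> real"
  assumes "p < n"
  shows "(\<Sum>i<n. g i * (q * indicator {i} p * r)) = g p * (q * r)"
proof -
  have "(\<Sum>i<n. g i * (q * indicator {i} p * r)) = (\<Sum>i<n. if i = p then g i * (q * r) else 0)"
    by (intro sum.cong) (auto simp: indicator_def)
  then show ?thesis using assms by simp
qed

lemma sum_mult_indicator_singleton2:
  fixes g :: "nat \<Rightarrow> nat \<Rightarrow> real"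
  assumes "p < n" "p' < n"
  shows "(\<Sum>i<n. \<Sum>j<n. g i j * (q * indicator {i} p * indicator {j} p')) = q * g p p'"
  using sum_mult_indicator_singleton[OF assms(1), of "\<lambda>i. g i p'" q 1]
    sum_mult_indicator_singleton[OF assms(2), of "g _" "q * indicator {_} p" 1]
  by simp

context gossip_dynamics
begin

section \<open>Expected change of an observable over a short window\<close>

lemma observable_squared_mean: "observable (squared_mean n)"
  unfolding squared_mean_def[abs_def]
  by (intro observable_power2 observable_divide observable_sum observable_component) simp

lemma observable_mean_of_squares: "observable (mean_of_squares n)"
  unfolding mean_of_squares_def[abs_def]
  by (intro observable_power2 observable_divide observable_sum observable_component) simp

lemma expectation_gossip_events:
  assumes s: "0 \<le> s" and h: "0 \<le> h" and ij: "i < n" "j < n" and \<phi>: "observable \<phi>"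
  shows "integrable M (\<lambda>\<omega>. \<phi> (x s \<omega>) * gossip_event s h i j (Ng s \<omega>) \<omega>)"
    and "expectation (\<lambda>\<omega>. \<phi> (x s \<omega>) * gossip_event s h i j (Ng s \<omega>) \<omega>) =
      p_gossip h / (real n)\<^sup>2 * expectation (\<lambda>\<omega>. \<phi> (x s \<omega>))"
proof -
  have "AE \<omega> in M. \<bar>gossip_event s h i j k \<omega>\<bar> \<le> 1" for k
    by (auto simp: gossip_event_def indicator_def)
  from expectation_mult_future[OF s h \<phi>, of "\<lambda>k l. gossip_event s h i j k", OF future_gossip_event[OF s h] this
      expectation_gossip_event[OF s h ij]]
  show "integrable M (\<lambda>\<omega>. \<phi> (x s \<omega>) * gossip_event s h i j (Ng s \<omega>) \<omega>)"
    "expectation (\<lambda>\<omega>. \<phi> (x s \<omega>) * gossip_event s h i j (Ng s \<omega>) \<omega>) =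
      p_gossip h / (real n)\<^sup>2 * expectation (\<lambda>\<omega>. \<phi> (x s \<omega>))" .
qed

lemma expectation_replacement_events:
  assumes s: "0 \<le> s" and h: "0 \<le> h" and i: "i < n" and \<phi>: "observable \<phi>"
    and \<mu>: "\<And>l. expectation (\<lambda>\<omega>. (z l \<omega>) ^ q) = \<mu>"
  shows "integrable M (\<lambda>\<omega>. \<phi> (x s \<omega>) * (replacement_event s h i (Nr s \<omega>) \<omega> * (z (Nr s \<omega>) \<omega>) ^ q))"
    and "expectation (\<lambda>\<omega>. \<phi> (x s \<omega>) * (replacement_event s h i (Nr s \<omega>) \<omega> * (z (Nr s \<omega>) \<omega>) ^ q)) =
      p_replacement h / real n * \<mu> * expectation (\<lambda>\<omega>. \<phi> (x s \<omega>))"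
proof -
  have bnd: "AE \<omega> in M. \<bar>replacement_event s h i l \<omega> * (z l \<omega>) ^ q\<bar> \<le> bound ^ q" for l
    using AE_arrivals_bound
  proof eventually_elim
    case (elim \<omega>)
    have "\<bar>replacement_event s h i l \<omega>\<bar> * \<bar>(z l \<omega>) ^ q\<bar> \<le> 1 * bound ^ q"
      using elim by (intro mult_mono) (auto simp: replacement_event_def indicator_def power_abs power_mono)
    then show ?case by (simp add: abs_mult)
  qed
  have e: "expectation (\<lambda>\<omega>. replacement_event s h i l \<omega> * (z l \<omega>) ^ q) = p_replacement h / real n * \<mu>" for l
    unfolding expectation_replacement_event[OF s h i] \<mu> ..
  from expectation_mult_future[OF s h \<phi>, of "\<lambda>k l \<omega>. replacement_event s h i l \<omega> * (z l \<omega>) ^ q",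
      OF future_replacement_event[OF s h] bnd e]
  show "integrable M (\<lambda>\<omega>. \<phi> (x s \<omega>) * (replacement_event s h i (Nr s \<omega>) \<omega> * (z (Nr s \<omega>) \<omega>) ^ q))"
    "expectation (\<lambda>\<omega>. \<phi> (x s \<omega>) * (replacement_event s h i (Nr s \<omega>) \<omega> * (z (Nr s \<omega>) \<omega>) ^ q)) =
      p_replacement h / real n * \<mu> * expectation (\<lambda>\<omega>. \<phi> (x s \<omega>))" .
qed

text \<open>\<open>L\<close> is the generator of the jump process applied to \<open>f\<close>: the
  gossip rate \<open>n * lam_g\<close> times the mean of \<open>\<gamma>\<close> over the
  \<open>n * n\<close> ordered pairs, plus the replacement rate \<open>n * lam_r\<close> times the
  mean effect over the \<open>n\<close> agents. Arrivals have mean \<open>0\<close> and second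
  moment \<open>\<sigma>\<^sup>2\<close>, which removes \<open>r1\<close> and weights
  \<open>r2\<close>.\<close>

lemma expectation_increment_estimate:
  assumes f: "observable f"
    and \<gamma>: "\<And>i j. i < n \<Longrightarrow> j < n \<Longrightarrow> observable (\<gamma> i j)"
    and f_gossip: "\<And>i j v. i < n \<Longrightarrow> j < n \<Longrightarrow> f (gossip i j v) = f v + \<gamma> i j v"
    and r: "\<And>i. i < n \<Longrightarrow> observable (r0 i)" "\<And>i. i < n \<Longrightarrow> observable (r1 i)" "\<And>i. i < n \<Longrightarrow> observable (r2 i)"
    and f_replacement: "\<And>i y v. i < n \<Longrightarrow> f (replacement i y v) = f v + (r0 i v + r1 i v * y + r2 i v * y\<^sup>2)"
    and L: "\<And>v. L v = lam_g * (\<Sum>i<n. \<Sum>j<n. \<gamma> i j v) / real n + lam_r * (\<Sum>i<n. r0 i v + \<sigma>\<^sup>2 * r2 i v)"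
  shows "\<exists>C. \<forall>s\<ge>0. \<forall>h\<ge>0. \<bar>expectation (\<lambda>\<omega>. f (x (s + h) \<omega>)) - expectation (\<lambda>\<omega>. f (x s \<omega>)) -
    h * expectation (\<lambda>\<omega>. L (x s \<omega>))\<bar> \<le> C * h\<^sup>2"
proof -
  define \<Gamma> where "\<Gamma> v = (\<Sum>i<n. \<Sum>j<n. \<gamma> i j v) / (real n)\<^sup>2" for v
  define P where "P v = (\<Sum>i<n. r0 i v + \<sigma>\<^sup>2 * r2 i v) / real n" for v
  have \<Gamma>: "observable \<Gamma>" and P: "observable P"
    unfolding \<Gamma>_def[abs_def] P_def[abs_def]
    by (intro observable_divide observable_sum observable_add observable_mult observable_const \<gamma> r; simp)+
  have n0: "real n \<noteq> 0" using n_pos by simp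
  have LGP: "L v = real n * lam_g * \<Gamma> v + real n * lam_r * P v" for v
    using n0 by (simp add: L \<Gamma>_def P_def power2_eq_square)
  obtain Cf where Cf: "0 \<le> Cf" "\<forall>s\<ge>0. AE \<omega> in M. \<bar>f (x s \<omega>)\<bar> \<le> Cf"
    using observable_bounded[OF f] by blast
  obtain C\<Gamma> where C\<Gamma>: "0 \<le> C\<Gamma>" "\<forall>s\<ge>0. \<bar>expectation (\<lambda>\<omega>. \<Gamma> (x s \<omega>))\<bar> \<le> C\<Gamma>"
    using observable_expectation_bounded[OF \<Gamma>] by blast
  obtain CP where CP: "0 \<le> CP" "\<forall>s\<ge>0. \<bar>expectation (\<lambda>\<omega>. P (x s \<omega>))\<bar> \<le> CP"
    using observable_expectation_bounded[OF P] by blast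
  \<comment> \<open>The first term accounts for windows with several activations, where
    \<open>f\<close> changes by at most \<open>2 * Cf\<close>; the others for linearizing
    \<open>p_gossip\<close> and \<open>p_replacement\<close>.\<close>
  define C where "C = 2 * Cf * rate\<^sup>2 + real n * lam_g * rate * C\<Gamma> + real n * lam_r * rate * CP"
  have "\<bar>expectation (\<lambda>\<omega>. f (x (s + h) \<omega>)) - expectation (\<lambda>\<omega>. f (x s \<omega>)) - h * expectation (\<lambda>\<omega>. L (x s \<omega>))\<bar> \<le> C * h\<^sup>2"
    if s: "0 \<le> s" and h: "0 \<le> h" for s h
  proof -
    have sh: "0 \<le> s + h" and s_le: "s \<le> s + h" using s h by simp_all
    let ?dg = "\<lambda>\<omega>. Ng (s + h) \<omega> - Ng s \<omega>" and ?dr = "\<lambda>\<omega>. Nr (s + h) \<omega> - Nr s \<omega>"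
    \<comment> \<open>Summing over fixed agents separates state from draw: each summand is an
      observable times a future variable, and only the pair actually selected contributes.\<close>
    define G where "G \<omega> = (\<Sum>i<n. \<Sum>j<n. \<gamma> i j (x s \<omega>) * gossip_event s h i j (Ng s \<omega>) \<omega>)" for \<omega>
    define R where "R q \<rho> \<omega> = (\<Sum>i<n. \<rho> i (x s \<omega>) * (replacement_event s h i (Nr s \<omega>) \<omega> * (z (Nr s \<omega>) \<omega>) ^ q))" for q \<rho> \<omega>
    have G_int: "integrable M G"
      unfolding G_def[abs_def]
      by (intro Bochner_Integration.integrable_sum expectation_gossip_events(1)[OF s h _ _ \<gamma>]) auto
    have "expectation G = (\<Sum>i<n. \<Sum>j<n. p_gossip h / (real n)\<^sup>2 * expectation (\<lambda>\<omega>. \<gamma> i j (x s \<omega>)))"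
    proof -
      have "expectation G = (\<Sum>i<n. expectation (\<lambda>\<omega>. \<Sum>j<n. \<gamma> i j (x s \<omega>) * gossip_event s h i j (Ng s \<omega>) \<omega>))"
        unfolding G_def[abs_def]
        by (intro Bochner_Integration.integral_sum Bochner_Integration.integrable_sum
            expectation_gossip_events(1)[OF s h _ _ \<gamma>]) auto
      also have "\<dots> = (\<Sum>i<n. \<Sum>j<n. expectation (\<lambda>\<omega>. \<gamma> i j (x s \<omega>) * gossip_event s h i j (Ng s \<omega>) \<omega>))"
        by (intro sum.cong[OF refl] Bochner_Integration.integral_sum expectation_gossip_events(1)[OF s h _ _ \<gamma>]) auto
      finally show ?thesis
        by (simp add: expectation_gossip_events(2)[OF s h _ _ \<gamma>])
    qed
    also have "\<dots> = p_gossip h * ((\<Sum>i<n. \<Sum>j<n. expectation (\<lambda>\<omega>. \<gamma> i j (x s \<omega>))) / (real n)\<^sup>2)"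
      by (simp add: sum_distrib_left[symmetric] sum_divide_distrib[symmetric])
    also have "(\<Sum>i<n. \<Sum>j<n. expectation (\<lambda>\<omega>. \<gamma> i j (x s \<omega>))) / (real n)\<^sup>2 = expectation (\<lambda>\<omega>. \<Gamma> (x s \<omega>))"
    proof -
      have "expectation (\<lambda>\<omega>. \<Sum>i<n. \<Sum>j<n. \<gamma> i j (x s \<omega>)) = (\<Sum>i<n. expectation (\<lambda>\<omega>. \<Sum>j<n. \<gamma> i j (x s \<omega>)))"
        by (intro Bochner_Integration.integral_sum observable_integrable[OF observable_sum s] \<gamma>) auto
      also have "\<dots> = (\<Sum>i<n. \<Sum>j<n. expectation (\<lambda>\<omega>. \<gamma> i j (x s \<omega>)))"
        by (intro sum.cong[OF refl] Bochner_Integration.integral_sum observable_integrable[OF \<gamma> s]) auto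
      finally show ?thesis by (simp add: \<Gamma>_def)
    qed
    finally have G_exp: "expectation G = p_gossip h * expectation (\<lambda>\<omega>. \<Gamma> (x s \<omega>))" .
    have R_int: "integrable M (R q \<rho>)"
      and R_exp: "expectation (R q \<rho>) = (\<Sum>i<n. p_replacement h / real n * \<mu> * expectation (\<lambda>\<omega>. \<rho> i (x s \<omega>)))"
      if "\<And>i. i < n \<Longrightarrow> observable (\<rho> i)" "\<And>l. expectation (\<lambda>\<omega>. (z l \<omega>) ^ q) = \<mu>" for q \<rho> \<mu>
    proof -
      show "integrable M (R q \<rho>)"
        unfolding R_def[abs_def] using that s h
        by (intro Bochner_Integration.integrable_sum expectation_replacement_events(1)) auto
      show "expectation (R q \<rho>) = (\<Sum>i<n. p_replacement h / real n * \<mu> * expectation (\<lambda>\<omega>. \<rho> i (x s \<omega>)))"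
      proof -
        have "expectation (R q \<rho>) = (\<Sum>i<n. expectation (\<lambda>\<omega>. \<rho> i (x s \<omega>) *
            (replacement_event s h i (Nr s \<omega>) \<omega> * (z (Nr s \<omega>) \<omega>) ^ q)))"
          unfolding R_def[abs_def] using that s h
          by (intro Bochner_Integration.integral_sum expectation_replacement_events(1)) auto
        also have "\<dots> = (\<Sum>i<n. p_replacement h / real n * \<mu> * expectation (\<lambda>\<omega>. \<rho> i (x s \<omega>)))"
          using that s h by (intro sum.cong refl expectation_replacement_events(2)) auto
        finally show ?thesis .
      qed
    qed
    have m0: "expectation (\<lambda>\<omega>. (z l \<omega>) ^ 0) = 1" and m1: "expectation (\<lambda>\<omega>. (z l \<omega>) ^ 1) = 0"
      and m2: "expectation (\<lambda>\<omega>. (z l \<omega>) ^ 2) = \<sigma>\<^sup>2" for l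
      using expectation_arrival_moments[of l] by (simp_all add: prob_space)
    have R_ints: "integrable M (R 0 r0)" "integrable M (R 1 r1)" "integrable M (R 2 r2)"
      by (rule R_int[OF r(1) m0] R_int[OF r(2) m1] R_int[OF r(3) m2]; assumption)+
    have "expectation (R 0 r0) + expectation (R 1 r1) + expectation (R 2 r2) =
      p_replacement h * ((\<Sum>i<n. expectation (\<lambda>\<omega>. r0 i (x s \<omega>)) + \<sigma>\<^sup>2 * expectation (\<lambda>\<omega>. r2 i (x s \<omega>))) / real n)"
    proof -
      have "expectation (R 0 r0) = (\<Sum>i<n. p_replacement h / real n * 1 * expectation (\<lambda>\<omega>. r0 i (x s \<omega>)))"
        by (rule R_exp[OF r(1) m0])
      moreover have "expectation (R 1 r1) = (\<Sum>i<n. p_replacement h / real n * 0 * expectation (\<lambda>\<omega>. r1 i (x s \<omega>)))"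
        by (rule R_exp[OF r(2) m1])
      moreover have "expectation (R 2 r2) = (\<Sum>i<n. p_replacement h / real n * \<sigma>\<^sup>2 * expectation (\<lambda>\<omega>. r2 i (x s \<omega>)))"
        by (rule R_exp[OF r(3) m2])
      ultimately show ?thesis
        by (simp only: sum.distrib sum_distrib_left[symmetric]) (simp add: algebra_simps add_divide_distrib)
    qed
    also have "(\<Sum>i<n. expectation (\<lambda>\<omega>. r0 i (x s \<omega>)) + \<sigma>\<^sup>2 * expectation (\<lambda>\<omega>. r2 i (x s \<omega>))) / real n =
        expectation (\<lambda>\<omega>. P (x s \<omega>))"
      unfolding P_def by (simp add: Bochner_Integration.integral_sum observable_integrable[OF r(1) s] observable_integrable[OF r(3) s])
    finally have R_total: "expectation (R 0 r0) + expectation (R 1 r1) + expectation (R 2 r2) =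
      p_replacement h * expectation (\<lambda>\<omega>. P (x s \<omega>))" .
    \<comment> \<open>Almost surely \<open>Q\<close> is the exact change of \<open>f\<close> when
      the window has at most one activation, and it is \<open>0\<close> otherwise.\<close>
    define Q where "Q \<omega> = G \<omega> + (R 0 r0 \<omega> + R 1 r1 \<omega> + R 2 r2 \<omega>)" for \<omega>
    have Q_int: "integrable M Q"
      unfolding Q_def[abs_def] by (intro Bochner_Integration.integrable_add G_int R_ints)
    have Q_exp: "expectation Q = p_gossip h * expectation (\<lambda>\<omega>. \<Gamma> (x s \<omega>)) + p_replacement h * expectation (\<lambda>\<omega>. P (x s \<omega>))"
      unfolding Q_def[abs_def] using G_int R_ints by (simp add: G_exp R_total[symmetric] del: One_nat_def)
    define F where "F \<omega> = f (x (s + h) \<omega>) - f (x s \<omega>)" for \<omega>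
    have F_int: "integrable M F"
      unfolding F_def[abs_def] by (intro Bochner_Integration.integrable_diff observable_integrable f s sh)
    have F_exp: "expectation F = expectation (\<lambda>\<omega>. f (x (s + h) \<omega>)) - expectation (\<lambda>\<omega>. f (x s \<omega>))"
      unfolding F_def[abs_def] by (intro Bochner_Integration.integral_diff observable_integrable f s sh)
    let ?A = "{\<omega> \<in> space M. \<not> ?dg \<omega> + ?dr \<omega> \<le> 1}"
    note u = grid_step_grid[OF s h zero_less_one]
    have A: "?A \<in> events"
      using multiple_activations_event[OF u, of 1] by simp
    have "AE \<omega> in M. \<bar>F \<omega> - Q \<omega>\<bar> \<le> 2 * Cf * indicator ?A \<omega>"
      using AE_transition[OF s s_le] AE_agents Cf(2)[rule_format, OF s]
        Cf(2)[rule_format, OF sh] AE_space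
    proof eventually_elim
      case (elim \<omega>)
      consider (bad) "\<not> ?dg \<omega> + ?dr \<omega> \<le> 1" | (none) "?dg \<omega> = 0" "?dr \<omega> = 0"
        | (gossip) "?dg \<omega> = 1" "?dr \<omega> = 0" | (replacement) "?dg \<omega> = 0" "?dr \<omega> = 1"
        by linarith
      then show ?case
      proof cases
        case bad
        then have "gossip_event s h i j k \<omega> = 0" "replacement_event s h i l \<omega> = 0" for i j k l
          by (auto simp: gossip_event_def replacement_event_def indicator_def)
        then have "Q \<omega> = 0" by (simp add: Q_def G_def R_def)
        with bad elim show ?thesis by (auto simp: F_def)
      next
        case none
        then have "gossip_event s h i j k \<omega> = 0" "replacement_event s h i l \<omega> = 0" for i j k l
          by (auto simp: gossip_event_def replacement_event_def indicator_def)
        then have "Q \<omega> = 0" by (simp add: Q_def G_def R_def)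
        moreover have "f (x (s + h) \<omega>) = f (x s \<omega>)"
          using none elim(1) by (intro observable_cong[OF f]) auto
        ultimately show ?thesis using Cf(1) by (simp add: F_def)
      next
        case gossip
        let ?p = "a (Ng s \<omega>) \<omega>" and ?q = "b (Ng s \<omega>) \<omega>"
        have pq: "?p < n" "?q < n" using elim(2) by auto
        have "replacement_event s h i l \<omega> = 0" for i l
          using gossip by (simp add: replacement_event_def)
        then have "R q \<rho> \<omega> = 0" for q \<rho> by (simp add: R_def)
        moreover have "G \<omega> = \<gamma> ?p ?q (x s \<omega>)"
          unfolding G_def gossip_event_def sum_mult_indicator_singleton2[OF pq] using gossip by simp
        moreover have "f (x (s + h) \<omega>) = f (gossip ?p ?q (x s \<omega>))"
          using gossip elim(1) by (intro observable_cong[OF f]) auto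
        ultimately show ?thesis using Cf(1) f_gossip[OF pq] by (simp add: F_def Q_def)
      next
        case replacement
        let ?p = "c (Nr s \<omega>) \<omega>"
        have p: "?p < n" using elim(2) by auto
        have "gossip_event s h i j k \<omega> = 0" for i j k
          using replacement by (simp add: gossip_event_def)
        then have "G \<omega> = 0" by (simp add: G_def)
        moreover have "R q \<rho> \<omega> = \<rho> ?p (x s \<omega>) * (z (Nr s \<omega>) \<omega>) ^ q" for q \<rho>
          unfolding R_def replacement_event_def sum_mult_indicator_singleton[OF p] using replacement by simp
        moreover have "f (x (s + h) \<omega>) = f (replacement ?p (z (Nr s \<omega>) \<omega>) (x s \<omega>))"
          using replacement elim(1) by (intro observable_cong[OF f]) auto
        ultimately show ?thesis using Cf(1) f_replacement[OF p] by (simp add: F_def Q_def)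
      qed
    qed
    then have "\<bar>expectation F - expectation Q\<bar> \<le> 2 * Cf * prob ?A"
      by (rule expectation_diff_le[OF F_int Q_int A])
    also have "\<dots> \<le> 2 * Cf * (rate * h)\<^sup>2"
      using prob_multiple_activations[OF u, of 1] Cf(1) by (intro mult_left_mono) simp_all
    finally have 1: "\<bar>expectation F - expectation Q\<bar> \<le> 2 * Cf * (rate * h)\<^sup>2" .
    have Lexp: "expectation (\<lambda>\<omega>. L (x s \<omega>)) =
        real n * lam_g * expectation (\<lambda>\<omega>. \<Gamma> (x s \<omega>)) + real n * lam_r * expectation (\<lambda>\<omega>. P (x s \<omega>))"
      unfolding LGP using observable_integrable[OF \<Gamma> s] observable_integrable[OF P s] by simp
    have 2: "\<bar>(p_gossip h - real n * lam_g * h) * expectation (\<lambda>\<omega>. \<Gamma> (x s \<omega>))\<bar> \<le> real n * lam_g * rate * h\<^sup>2 * C\<Gamma>"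
      unfolding abs_mult using p_gossip_approx[OF h] C\<Gamma> s by (intro mult_mono) (auto intro: order_trans[OF abs_ge_zero])
    have 3: "\<bar>(p_replacement h - real n * lam_r * h) * expectation (\<lambda>\<omega>. P (x s \<omega>))\<bar> \<le> real n * lam_r * rate * h\<^sup>2 * CP"
      unfolding abs_mult using p_replacement_approx[OF h] CP s by (intro mult_mono) (auto intro: order_trans[OF abs_ge_zero])
    have "expectation F - h * expectation (\<lambda>\<omega>. L (x s \<omega>)) = (expectation F - expectation Q) +
      (p_gossip h - real n * lam_g * h) * expectation (\<lambda>\<omega>. \<Gamma> (x s \<omega>)) +
      (p_replacement h - real n * lam_r * h) * expectation (\<lambda>\<omega>. P (x s \<omega>))"
      unfolding Lexp Q_exp by (simp add: algebra_simps)
    then have "\<bar>expectation F - h * expectation (\<lambda>\<omega>. L (x s \<omega>))\<bar> \<le>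
      2 * Cf * (rate * h)\<^sup>2 + real n * lam_g * rate * h\<^sup>2 * C\<Gamma> + real n * lam_r * rate * h\<^sup>2 * CP"
      using 1 2 3 by linarith
    also have "\<dots> = C * h\<^sup>2"
      by (simp add: C_def algebra_simps power_mult_distrib)
    finally show ?thesis unfolding F_exp .
  qed
  then show ?thesis by blast
qed


section \<open>The differential equations of the two moments\<close>

definition E_squared_mean :: "real \<Rightarrow> real" where "E_squared_mean s = expectation (\<lambda>\<omega>. squared_mean n (x s \<omega>))"
definition E_mean_of_squares :: "real \<Rightarrow> real" where "E_mean_of_squares s = expectation (\<lambda>\<omega>. mean_of_squares n (x s \<omega>))"

definition drift_squared_mean :: "real \<Rightarrow> real" where
  "drift_squared_mean s = - 2 * lam_r * E_squared_mean s + lam_r / real n * E_mean_of_squares s + lam_r * \<sigma>\<^sup>2 / real n"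
definition drift_mean_of_squares :: "real \<Rightarrow> real" where
  "drift_mean_of_squares s = lam_g * E_squared_mean s - (lam_g + lam_r) * E_mean_of_squares s + lam_r * \<sigma>\<^sup>2"

text \<open>Gossip preserves the sum \<open>S\<close> of the values, so only replacements
  contribute. Summing \<open>v\<^sub>i\<^sup>2 - 2 * S * v\<^sub>i\<close> over the leaving agent
  gives the sum of squares minus \<open>2 * S\<^sup>2\<close>, whence the coefficients
  \<open>lam_r / n\<close> and \<open>- 2 * lam_r\<close>.\<close>

lemma squared_mean_estimate:
  "\<exists>C. \<forall>s\<ge>0. \<forall>h\<ge>0. \<bar>E_squared_mean (s + h) - E_squared_mean s - h * drift_squared_mean s\<bar> \<le> C * h\<^sup>2"
proof -
  define L where "L v = - 2 * lam_r * squared_mean n v + lam_r / real n * mean_of_squares n v + lam_r * \<sigma>\<^sup>2 / real n" for v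
  have n0: "real n \<noteq> 0" using n_pos by simp
  have "\<exists>C. \<forall>s\<ge>0. \<forall>h\<ge>0. \<bar>E_squared_mean (s + h) - E_squared_mean s - h * expectation (\<lambda>\<omega>. L (x s \<omega>))\<bar> \<le> C * h\<^sup>2"
    unfolding E_squared_mean_def
  proof (rule expectation_increment_estimate[where \<gamma> = "\<lambda>_ _ _. 0"
        and ?r0.0 = "\<lambda>i v. (((\<Sum>m<n. v m) - v i)\<^sup>2 - (\<Sum>m<n. v m)\<^sup>2) / (real n)\<^sup>2"
        and ?r1.0 = "\<lambda>i v. 2 * ((\<Sum>m<n. v m) - v i) / (real n)\<^sup>2"
        and ?r2.0 = "\<lambda>_ _. 1 / (real n)\<^sup>2", OF observable_squared_mean])
    fix v :: "nat \<Rightarrow> real"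
    let ?S = "\<Sum>m<n. v m" and ?Q = "\<Sum>m<n. (v m)\<^sup>2"
    have "(\<Sum>i<n. ((?S - v i)\<^sup>2 - ?S\<^sup>2) / (real n)\<^sup>2 + \<sigma>\<^sup>2 * (1 / (real n)\<^sup>2)) =
        (\<Sum>i<n. (v i)\<^sup>2 / (real n)\<^sup>2 - 2 * ?S / (real n)\<^sup>2 * v i + \<sigma>\<^sup>2 / (real n)\<^sup>2)"
      by (intro sum.cong refl) (simp add: power2_diff diff_divide_distrib)
    also have "\<dots> = ?Q / (real n)\<^sup>2 - 2 * ?S / (real n)\<^sup>2 * ?S + real n * (\<sigma>\<^sup>2 / (real n)\<^sup>2)"
      by (simp add: sum.distrib sum_subtractf sum_distrib_left[symmetric] sum_divide_distrib[symmetric])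
    finally have *: "(\<Sum>i<n. ((?S - v i)\<^sup>2 - ?S\<^sup>2) / (real n)\<^sup>2 + \<sigma>\<^sup>2 * (1 / (real n)\<^sup>2)) =
        ?Q / (real n)\<^sup>2 - 2 * ?S / (real n)\<^sup>2 * ?S + real n * (\<sigma>\<^sup>2 / (real n)\<^sup>2)" .
    show "L v = lam_g * (\<Sum>i<n. \<Sum>j<n. 0) / real n +
        lam_r * (\<Sum>i<n. ((?S - v i)\<^sup>2 - ?S\<^sup>2) / (real n)\<^sup>2 + \<sigma>\<^sup>2 * (1 / (real n)\<^sup>2))"
      unfolding * using n0 by (simp add: L_def squared_mean_def mean_of_squares_def field_simps power2_eq_square)
  qed (simp_all add: squared_mean_gossip squared_mean_replacement, (intro observable_divide observable_diff observable_power2 observable_mult observable_const observable_sum observable_component; simp)+)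
  moreover have "expectation (\<lambda>\<omega>. L (x s \<omega>)) = drift_squared_mean s" if "0 \<le> s" for s
    unfolding L_def drift_squared_mean_def E_squared_mean_def E_mean_of_squares_def
    using observable_integrable[OF observable_squared_mean that] observable_integrable[OF observable_mean_of_squares that]
    by (simp add: prob_space)
  ultimately show ?thesis by simp
qed

text \<open>Averaged over all pairs, the loss \<open>(v i - v j)\<^sup>2 / (2 * n)\<close> is the
  variance of the values divided by \<open>n\<close>; at rate \<open>n * lam_g\<close> this yields
  \<open>lam_g\<close> times the difference of the two descriptors.\<close>

lemma mean_of_squares_estimate:
  "\<exists>C. \<forall>s\<ge>0. \<forall>h\<ge>0. \<bar>E_mean_of_squares (s + h) - E_mean_of_squares s - h * drift_mean_of_squares s\<bar> \<le> C * h\<^sup>2"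
proof -
  define L where "L v = lam_g * squared_mean n v - (lam_g + lam_r) * mean_of_squares n v + lam_r * \<sigma>\<^sup>2" for v
  have n0: "real n \<noteq> 0" using n_pos by simp
  have "\<exists>C. \<forall>s\<ge>0. \<forall>h\<ge>0. \<bar>E_mean_of_squares (s + h) - E_mean_of_squares s - h * expectation (\<lambda>\<omega>. L (x s \<omega>))\<bar> \<le> C * h\<^sup>2"
    unfolding E_mean_of_squares_def
  proof (rule expectation_increment_estimate[where \<gamma> = "\<lambda>i j v. - (v i - v j)\<^sup>2 / (2 * real n)"
        and ?r0.0 = "\<lambda>i v. - (v i)\<^sup>2 / real n" and ?r1.0 = "\<lambda>_ _. 0"
        and ?r2.0 = "\<lambda>_ _. 1 / real n", OF observable_mean_of_squares])
    fix v :: "nat \<Rightarrow> real"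
    let ?S = "\<Sum>m<n. v m" and ?Q = "\<Sum>m<n. (v m)\<^sup>2"
    have "(\<Sum>i<n. \<Sum>j<n. - (v i - v j)\<^sup>2 / (2 * real n)) = - (\<Sum>i<n. \<Sum>j<n. (v i - v j)\<^sup>2) / (2 * real n)"
      by (simp add: sum_negf sum_divide_distrib)
    also have "\<dots> = - (2 * real n * ?Q - 2 * ?S\<^sup>2) / (2 * real n)"
      unfolding sum_pairwise_square_diff ..
    finally have 1: "(\<Sum>i<n. \<Sum>j<n. - (v i - v j)\<^sup>2 / (2 * real n)) = - (2 * real n * ?Q - 2 * ?S\<^sup>2) / (2 * real n)" .
    have 2: "(\<Sum>i<n. - (v i)\<^sup>2 / real n + \<sigma>\<^sup>2 * (1 / real n)) = - ?Q / real n + \<sigma>\<^sup>2"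
      using n0 by (simp add: sum.distrib sum_subtractf sum_negf sum_divide_distrib[symmetric])
    show "L v = lam_g * (\<Sum>i<n. \<Sum>j<n. - (v i - v j)\<^sup>2 / (2 * real n)) / real n +
        lam_r * (\<Sum>i<n. - (v i)\<^sup>2 / real n + \<sigma>\<^sup>2 * (1 / real n))"
      unfolding 1 2 using n0 by (simp add: L_def squared_mean_def mean_of_squares_def field_simps power2_eq_square)
  next
    fix i j assume "i < n" "j < n"
    then have "observable (\<lambda>v. (- 1) * (v i - v j)\<^sup>2 / (2 * real n))"
      by (intro observable_divide observable_diff observable_power2 observable_mult observable_const observable_component)
    then show "observable (\<lambda>v. - (v i - v j)\<^sup>2 / (2 * real n))" by simp
  next
    fix i assume "i < n"
    then have "observable (\<lambda>v. (- 1) * (v i)\<^sup>2 / real n)"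
      by (intro observable_divide observable_power2 observable_mult observable_const observable_component)
    then show "observable (\<lambda>v. - (v i)\<^sup>2 / real n)" by simp
  qed (simp_all only: mean_of_squares_gossip mean_of_squares_replacement observable_const)
  moreover have "expectation (\<lambda>\<omega>. L (x s \<omega>)) = drift_mean_of_squares s" if "0 \<le> s" for s
    unfolding L_def drift_mean_of_squares_def E_squared_mean_def E_mean_of_squares_def
    using observable_integrable[OF observable_squared_mean that] observable_integrable[OF observable_mean_of_squares that]
    by (simp add: prob_space)
  ultimately show ?thesis by simp
qed

text \<open>The Lipschitz condition on the drift comes from the same estimates: bounded drifts and
  \<open>h \<le> 1\<close> make both moments Lipschitz, and the drifts are affine in the
  moments.\<close>

lemma moments_derivative:
  assumes t: "0 \<le> t"
  shows "(E_squared_mean has_real_derivative drift_squared_mean t) (at t within {0..})" "(E_mean_of_squares has_real_derivative drift_mean_of_squares t) (at t within {0..})"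
proof -
  obtain C1 C2 where est: "\<forall>s\<ge>0. \<forall>h\<ge>0. \<bar>E_squared_mean (s + h) - E_squared_mean s - h * drift_squared_mean s\<bar> \<le> C1 * h\<^sup>2"
    "\<forall>s\<ge>0. \<forall>h\<ge>0. \<bar>E_mean_of_squares (s + h) - E_mean_of_squares s - h * drift_mean_of_squares s\<bar> \<le> C2 * h\<^sup>2"
    using squared_mean_estimate mean_of_squares_estimate by blast
  obtain B1 B2 where B: "0 \<le> B1" "\<forall>s\<ge>0. \<bar>E_squared_mean s\<bar> \<le> B1" "0 \<le> B2" "\<forall>s\<ge>0. \<bar>E_mean_of_squares s\<bar> \<le> B2"
    using observable_expectation_bounded[OF observable_squared_mean]
      observable_expectation_bounded[OF observable_mean_of_squares] unfolding E_squared_mean_def E_mean_of_squares_def by blast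
  have lin_bound: "\<bar>p * E_squared_mean s + q * E_mean_of_squares s + r\<bar> \<le> \<bar>p\<bar> * B1 + \<bar>q\<bar> * B2 + \<bar>r\<bar>" if "0 \<le> s" for p q r s
  proof -
    have "\<bar>p * E_squared_mean s\<bar> \<le> \<bar>p\<bar> * B1" "\<bar>q * E_mean_of_squares s\<bar> \<le> \<bar>q\<bar> * B2"
      unfolding abs_mult using B that by (auto intro: mult_left_mono)
    then show ?thesis by linarith
  qed
  have drift_squared_mean_lin: "drift_squared_mean s = (- 2 * lam_r) * E_squared_mean s + (lam_r / real n) * E_mean_of_squares s + lam_r * \<sigma>\<^sup>2 / real n"
    and drift_mean_of_squares_lin: "drift_mean_of_squares s = lam_g * E_squared_mean s + (- (lam_g + lam_r)) * E_mean_of_squares s + lam_r * \<sigma>\<^sup>2" for s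
    by (simp_all add: drift_squared_mean_def drift_mean_of_squares_def algebra_simps)
  obtain K1 K2 where K: "\<And>s. 0 \<le> s \<Longrightarrow> \<bar>drift_squared_mean s\<bar> \<le> K1" "\<And>s. 0 \<le> s \<Longrightarrow> \<bar>drift_mean_of_squares s\<bar> \<le> K2"
    using lin_bound unfolding drift_squared_mean_lin drift_mean_of_squares_lin by metis
  have lip: "\<bar>e (s + h) - e s\<bar> \<le> (\<bar>C\<bar> + K) * h"
    if "\<forall>s\<ge>0. \<forall>h\<ge>0. \<bar>e (s + h) - e s - h * g s\<bar> \<le> C * h\<^sup>2" "\<And>s. 0 \<le> s \<Longrightarrow> \<bar>g s\<bar> \<le> K"
      "0 \<le> s" "0 \<le> h" "h \<le> 1" for e g :: "real \<Rightarrow> real" and C K s h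
  proof -
    have "\<bar>e (s + h) - e s - h * g s\<bar> \<le> C * h\<^sup>2" using that by blast
    moreover have "C * h\<^sup>2 \<le> \<bar>C\<bar> * h"
      using that by (intro mult_mono) (auto simp: power2_eq_square mult_left_le)
    moreover have "\<bar>h * g s\<bar> \<le> h * K"
      unfolding abs_mult using that by (auto intro: mult_left_mono)
    ultimately show ?thesis
      by (simp add: algebra_simps)
  qed
  have lip1: "\<bar>E_squared_mean (s + h) - E_squared_mean s\<bar> \<le> (\<bar>C1\<bar> + K1) * h" and lip2: "\<bar>E_mean_of_squares (s + h) - E_mean_of_squares s\<bar> \<le> (\<bar>C2\<bar> + K2) * h"
    if "0 \<le> s" "0 \<le> h" "h \<le> 1" for s h
    by (rule lip[OF est(1) _ that], rule K(1), assumption) (rule lip[OF est(2) _ that], rule K(2))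
  have lin_lip: "\<bar>(p * E_squared_mean (s + h) + q * E_mean_of_squares (s + h) + r) - (p * E_squared_mean s + q * E_mean_of_squares s + r)\<bar> \<le>
      (\<bar>p\<bar> * (\<bar>C1\<bar> + K1) + \<bar>q\<bar> * (\<bar>C2\<bar> + K2)) * h" if "0 \<le> s" "0 \<le> h" "h \<le> 1" for p q r s h
  proof -
    have "\<bar>p * (E_squared_mean (s + h) - E_squared_mean s)\<bar> \<le> \<bar>p\<bar> * ((\<bar>C1\<bar> + K1) * h)" "\<bar>q * (E_mean_of_squares (s + h) - E_mean_of_squares s)\<bar> \<le> \<bar>q\<bar> * ((\<bar>C2\<bar> + K2) * h)"
      unfolding abs_mult using lip1[OF that] lip2[OF that] by (auto intro: mult_left_mono)
    then show ?thesis
      by (simp add: algebra_simps) linarith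
  qed
  show "(E_squared_mean has_real_derivative drift_squared_mean t) (at t within {0..})"
    by (rule has_real_derivative_from_increments[OF _ _ t]) (use est(1) in blast, unfold drift_squared_mean_lin, rule lin_lip)
  show "(E_mean_of_squares has_real_derivative drift_mean_of_squares t) (at t within {0..})"
    by (rule has_real_derivative_from_increments[OF _ _ t]) (use est(2) in blast, unfold drift_mean_of_squares_lin, rule lin_lip)
qed

text \<open>Constant basis vectors with scalar coefficients reduce vector-valued expectations and
  derivatives to scalar ones.\<close>

lemma descriptors_axis:
  "descriptors n v = squared_mean n v *\<^sub>R axis 1 1 + mean_of_squares n v *\<^sub>R axis 2 1"
  by (simp add: vec_eq_iff forall_2 descriptors_def axis_def)

lemma expectation_descriptors:
  assumes "0 \<le> s"
  shows "expectation (\<lambda>\<omega>. descriptors n (x s \<omega>)) = E_squared_mean s *\<^sub>R axis 1 1 + E_mean_of_squares s *\<^sub>R axis 2 1"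
  unfolding descriptors_axis E_squared_mean_def E_mean_of_squares_def
  using observable_integrable[OF observable_squared_mean assms] observable_integrable[OF observable_mean_of_squares assms]
  by simp

lemma descriptors_derivative:
  assumes t: "0 \<le> t"
  shows "((\<lambda>s. expectation (\<lambda>\<omega>. descriptors n (x s \<omega>))) has_vector_derivative
      ((vector [vector [- 2 * lam_r, lam_r / real n],
                vector [lam_g, - (lam_g + lam_r)]] :: real ^ 2 ^ 2) *v expectation (\<lambda>\<omega>. descriptors n (x t \<omega>))
       + lam_r *\<^sub>R (\<sigma>\<^sup>2 *\<^sub>R vector [1 / real n, 1]))) (at t within {0..})"
\<comment> \<open>The expectation has this form for nonnegative times, which is all that a
  derivative within \<open>{0..}\<close> sees.\<close>
proof (rule has_vector_derivative_transform[where f = "\<lambda>s. E_squared_mean s *\<^sub>R axis 1 1 + E_mean_of_squares s *\<^sub>R axis 2 1"])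
  have "((\<lambda>s. E_squared_mean s *\<^sub>R axis 1 1 + E_mean_of_squares s *\<^sub>R axis 2 1) has_vector_derivative
      (E_squared_mean t *\<^sub>R 0 + drift_squared_mean t *\<^sub>R axis 1 1) + (E_mean_of_squares t *\<^sub>R 0 + drift_mean_of_squares t *\<^sub>R axis 2 1)) (at t within {0..})"
    by (intro has_vector_derivative_add has_vector_derivative_scaleR moments_derivative t has_vector_derivative_const)
  also have "(E_squared_mean t *\<^sub>R 0 + drift_squared_mean t *\<^sub>R axis 1 1) + (E_mean_of_squares t *\<^sub>R 0 + drift_mean_of_squares t *\<^sub>R axis 2 1) =
      ((vector [vector [- 2 * lam_r, lam_r / real n],
                vector [lam_g, - (lam_g + lam_r)]] :: real ^ 2 ^ 2) *v expectation (\<lambda>\<omega>. descriptors n (x t \<omega>))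
       + lam_r *\<^sub>R (\<sigma>\<^sup>2 *\<^sub>R vector [1 / real n, 1]))"
    unfolding expectation_descriptors[OF t] drift_squared_mean_def drift_mean_of_squares_def
    by (simp add: vec_eq_iff forall_2 matrix_vector_mult_def sum_2 axis_def) (simp add: algebra_simps)
  finally show "((\<lambda>s. E_squared_mean s *\<^sub>R axis 1 1 + E_mean_of_squares s *\<^sub>R axis 2 1) has_vector_derivative
      ((vector [vector [- 2 * lam_r, lam_r / real n],
                vector [lam_g, - (lam_g + lam_r)]] :: real ^ 2 ^ 2) *v expectation (\<lambda>\<omega>. descriptors n (x t \<omega>))
       + lam_r *\<^sub>R (\<sigma>\<^sup>2 *\<^sub>R vector [1 / real n, 1]))) (at t within {0..})" .
qed (use t expectation_descriptors in auto)

end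

theorem theorem1:
  fixes M :: "'w measure"
    and n :: nat
    and lam_g lam_r \<sigma> :: real
    and D :: "real measure"
    and Ng Nr :: "real \<Rightarrow> 'w \<Rightarrow> nat"
    and a b c :: "nat \<Rightarrow> 'w \<Rightarrow> nat"
    and z :: "nat \<Rightarrow> 'w \<Rightarrow> real"
    and x :: "real \<Rightarrow> 'w \<Rightarrow> nat \<Rightarrow> real"
    and mX :: "real \<Rightarrow> real ^ 2"
    and t :: real
  assumes "n \<ge> 1" and "lam_g \<ge> 0" and "lam_r \<ge> 0"
    and "open_gossip_system M n lam_g lam_r D \<sigma> Ng Nr a b c z x"
    and mX: "\<And>t. mX t = prob_space.expectation M (\<lambda>\<omega>. descriptors n (x t \<omega>))"
    and "t \<ge> 0"
  shows "(mX has_vector_derivative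
      ((vector [vector [- 2 * lam_r, lam_r / real n],
                vector [lam_g, - (lam_g + lam_r)]] :: real ^ 2 ^ 2) *v mX t
       + lam_r *\<^sub>R (\<sigma>\<^sup>2 *\<^sub>R vector [1 / real n, 1]))) (at t within {0..})"
proof -
  interpret gossip_dynamics M n lam_g lam_r D \<sigma> Ng Nr a b c z x
    using assms by (simp add: gossip_dynamics_def gossip_dynamics_axioms_def)
  have "mX = (\<lambda>s. expectation (\<lambda>\<omega>. descriptors n (x s \<omega>)))"
    using mX by auto
  with descriptors_derivative[OF \<open>t \<ge> 0\<close>] show ?thesis by simp
qed

end
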